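(* For $m\ge1$ let $F_m(t)=\sum_{r\ge0}b(m^r)t^r$ and $F^*_m(t)=\sum_{r\ge0}b^*(m^r)t^r$, where $b(m^r)$ (resp. $b^*(m^r)$) is the number of alternating (resp. reverse alternating) permutations in $\mathfrak S_{mr}$ all of whose cycles have length $m$ (cycle type $\langle m^r\rangle$). Then, umbrally: (a) If $m$ is odd and $m\ge3$, $$F_m(t)=F^*_m(t)=\exp\left[\frac1m\left(\sum_{d\mid m}\mu(d)(-1)^{(d-1)/2}E^{m/d}\right)\tan^{-1}t\right].$$ (b) $F_1(t)=\sinh(E\tan^{-1}t)+\frac{1}{\sqrt{1+t^2}}\cosh(E\tan^{-1}t)$ and $F_1^*(t)=\sinh(E\tan^{-1}t)+\sqrt{1+t^2}\cosh(E\tan^{-1}t)$.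
   Context: A permutation $a_1\cdots a_n$ is alternating if $a_1>a_2<a_3>\cdots$ and reverse alternating if $a_1<a_2>a_3<\cdots$. $\mu$ is the Möbius function and $\tan^{-1}$ is the arctangent power series. Euler numbers $E_n$: $\sum_{n\ge0}E_nx^n/n!=\sec x+\tan x$. Umbral evaluation: the right-hand sides are expanded as formal power series in $t$ whose coefficients are polynomials in an indeterminate $E$; each coefficient is expanded in powers of $E$ and then, as the last step, each $E^k$ is replaced by $E_k$. *)

theory Defs
  imports
    Complex_Main
    "HOL-Computational_Algebra.Computational_Algebra"
    "HOL-Combinatorics.Permutations"
    "HOL-Combinatorics.Orbits"
begin

text \<open>
  A permutation of \<open>{1..n}\<close> is a function \<open>p\<close> with \<open>p permutes {1..n}\<close>; the associated word
  is \<open>p 1, \<dots>, p n\<close>.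
\<close>

definition alternating :: "nat \<Rightarrow> (nat \<Rightarrow> nat) \<Rightarrow> bool" where
  "alternating n p \<longleftrightarrow>
     (\<forall>i. 1 \<le> i \<and> i < n \<longrightarrow> (if odd i then p i > p (i + 1) else p i < p (i + 1)))"

definition reverse_alternating :: "nat \<Rightarrow> (nat \<Rightarrow> nat) \<Rightarrow> bool" where
  "reverse_alternating n p \<longleftrightarrow>
     (\<forall>i. 1 \<le> i \<and> i < n \<longrightarrow> (if odd i then p i < p (i + 1) else p i > p (i + 1)))"

text \<open>The cycles, fixed points included, are represented by their underlying sets.\<close>

definition perm_cycles :: "nat \<Rightarrow> (nat \<Rightarrow> nat) \<Rightarrow> nat set set" where
  "perm_cycles n p = orbit p ` {1..n}"

definition b_alt :: "nat \<Rightarrow> nat \<Rightarrow> nat" where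
  "b_alt m r = card {p. p permutes {1..m * r} \<and> alternating (m * r) p \<and>
                    (\<forall>C \<in> perm_cycles (m * r) p. card C = m)}"

definition b_star :: "nat \<Rightarrow> nat \<Rightarrow> nat" where
  "b_star m r = card {p. p permutes {1..m * r} \<and> reverse_alternating (m * r) p \<and>
                         (\<forall>C \<in> perm_cycles (m * r) p. card C = m)}"

definition F_alt :: "nat \<Rightarrow> real fps" where
  "F_alt m = Abs_fps (\<lambda>r. real (b_alt m r))"

definition F_star :: "nat \<Rightarrow> real fps" where
  "F_star m = Abs_fps (\<lambda>r. real (b_star m r))"

definition moebius_mu :: "nat \<Rightarrow> int" where
  "moebius_mu n = (if squarefree n then (-1) ^ card (prime_factors n) else 0)"

definition euler_number :: "nat \<Rightarrow> real" where
  "euler_number n = fact n * fps_nth (inverse (fps_cos 1) + fps_tan 1) n"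

definition fps_arctan :: "real fps" where
  "fps_arctan = Abs_fps (\<lambda>n. if odd n then (-1) ^ ((n - 1) div 2) / real n else 0)"

definition fps_sinh :: "real fps" where
  "fps_sinh = Abs_fps (\<lambda>n. if odd n then 1 / fact n else 0)"

definition fps_cosh :: "real fps" where
  "fps_cosh = Abs_fps (\<lambda>n. if even n then 1 / fact n else 0)"

text \<open>\<open>\<surd>(1 + t\<^sup>2)\<close>, normalised to have constant term \<open>1\<close>.\<close>

definition fps_sqrt_1_plus_sq :: "real fps" where
  "fps_sqrt_1_plus_sq = fps_radical root 2 (1 + fps_X ^ 2)"

text \<open>
  Formal power series in \<open>t\<close> over polynomials in the indeterminate \<open>E\<close> are elements of
  \<^typ>\<open>real poly fps\<close>. The embedding below has coefficients constant in \<open>E\<close>.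
\<close>

definition const_in_E :: "real fps \<Rightarrow> real poly fps" where
  "const_in_E f = Abs_fps (\<lambda>n. [:fps_nth f n:])"

definition umbral_E :: "real poly fps" where
  "umbral_E = fps_const (monom 1 1)"

definition umbral_eval_poly :: "real poly \<Rightarrow> real" where
  "umbral_eval_poly q = (\<Sum>k\<le>degree q. coeff q k * euler_number k)"

definition umbral_eval :: "real poly fps \<Rightarrow> real fps" where
  "umbral_eval f = Abs_fps (\<lambda>n. umbral_eval_poly (fps_nth f n))"

text \<open>
  The coefficient of \<open>tan\<^sup>-\<^sup>1 t\<close> in the exponent. It is meant for odd \<open>m\<close>, where every
  divisor \<open>d\<close> is odd and \<open>(d - 1) div 2\<close> is exact.
\<close>

definition cycle_poly :: "nat \<Rightarrow> real poly fps" where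
  "cycle_poly m =
     fps_const [:1 / real m:] *
     (\<Sum>d | d dvd m. fps_const [:of_int (moebius_mu d) * (-1) ^ ((d - 1) div 2):] * umbral_E ^ (m div d))"

end

theory Submission
  imports Defs "HOL-Library.List_Lexorder"
begin

text \<open>
  A permutation that increases on prescribed consecutive blocks is determined by the itineraries of its
  points through the blocks: they are ordered lexicographically, and the itineraries along the cycles
  form a multiset of primitive necklaces (Gessel-Reutenauer). Hence the permutations of cycle type
  \<open>m\<^sup>r\<close> with descents in a given set are counted by the coefficients of \<open>h\<^sub>r[L\<^sub>m]\<close>, where
  \<open>m L\<^sub>m\<close> is the sum of \<open>\<mu>(d) p\<^sub>d ^ (m / d)\<close> over \<open>d\<close> dividing \<open>m\<close>, and Newton's identity
  expresses \<open>m r h\<^sub>r[L\<^sub>m]\<close> through \<open>p\<^sub>k[m L\<^sub>m] h\<^bsub>r-k\<^esub>[L\<^sub>m]\<close>. Inclusion-exclusion over descent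
  sets is a linear functional that, up to sign, only sees the parity of \<open>j\<close> in a factor \<open>p\<^sub>j\<close> and
  maps \<open>p\<^sub>1 ^ n\<close> to the Euler number \<open>E\<^sub>n\<close> (Foulkes). The terms with even \<open>k\<close> cancel because
  \<open>\<mu>\<close> sums to zero over the divisors of \<open>m > 1\<close>, and those with odd \<open>k\<close> give the recurrence satisfied
  by the coefficients of \<open>exp (C * arctan t)\<close>. For \<open>m = 1\<close> only the identity permutation
  counts, and both sides reduce to \<open>tan (arctan t) = t\<close> and \<open>sec (arctan t) = sqrt (1 + t\<^sup>2)\<close>.
\<close>

subsection \<open>Permutations and multisets of necklaces\<close>

text \<open>Power series are represented by functions on exponent lists, and \<open>ribbon\<close>
  reads them only at compositions whose interior partial sums have a fixed parity. This makes the
  parity phenomenon elementary: enlarging a part by 2 keeps the number of parts and all those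
  parities, but \<open>parity_positions\<close> gains one element, so trading \<open>p_(j+2)\<close>
  for \<open>p_j\<close> costs one sign. Only \<open>p_2\<close> needs more, because removing a part
  2 leaves a zero exponent.

  The obstacle in transferring Newton's identity is that umbral evaluation is not multiplicative:
  the value belonging to \<open>h_(r-k)[L_m]\<close> says nothing about the value after a
  multiplication by \<open>E ^ (m / d)\<close>. The induction therefore treats all products of
  \<open>p_1 ^ l\<close> with \<open>h_r[L_m]\<close> at once, with \<open>E ^ l\<close> on the
  polynomial side.

  The arctangent enters through its derivative \<open>1 / (1 + t^2)\<close>, whose coefficients are
  the signs \<open>(-1) ^ ((k - 1) / 2)\<close>, \<open>k\<close> odd, that arise when
  \<open>p_k\<close> is traded for \<open>p_1\<close>. The sign attached to \<open>d\<close> in the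
  exponent has the same origin.\<close>

lemma count_mset_map_upt:
  "count (mset (map h [1..<Suc n])) v = card {i \<in> {1..n}. h i = v}"
proof -
  have "count (mset (map h xs)) v = length (filter (\<lambda>i. h i = v) xs)" for xs
    by (induction xs) auto
  then have "count (mset (map h [1..<Suc n])) v = length (filter (\<lambda>i. h i = v) [1..<Suc n])" .
  also have "\<dots> = card (set (filter (\<lambda>i. h i = v) [1..<Suc n]))"
    by (rule distinct_card[symmetric]) simp
  also have "set (filter (\<lambda>i. h i = v) [1..<Suc n]) = {i \<in> {1..n}. h i = v}"
    by (auto simp del: upt_Suc)
  finally show ?thesis .
qed

text \<open>A monotone function on \<open>{1..n}\<close> lists the multiset of its values in sorted
  order, and a multiset has only one sorted list.\<close>

lemma mono_eq_of_card_fibres: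
  fixes f g :: "nat \<Rightarrow> 'a :: linorder"
  assumes f: "\<And>i j. 1 \<le> i \<Longrightarrow> i \<le> j \<Longrightarrow> j \<le> n \<Longrightarrow> f i \<le> f j"
    and g: "\<And>i j. 1 \<le> i \<Longrightarrow> i \<le> j \<Longrightarrow> j \<le> n \<Longrightarrow> g i \<le> g j"
    and card: "\<And>v. card {i \<in> {1..n}. f i = v} = card {i \<in> {1..n}. g i = v}"
    and i: "i \<in> {1..n}"
  shows "f i = g i"
proof -
  have sorted: "sorted (map h [1..<Suc n])"
    if "\<And>i j. 1 \<le> i \<Longrightarrow> i \<le> j \<Longrightarrow> j \<le> n \<Longrightarrow> h i \<le> h j" for h :: "nat \<Rightarrow> 'a"
    using that by (auto simp: sorted_iff_nth_mono simp del: upt_Suc)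
  have "mset (map f [1..<Suc n]) = mset (map g [1..<Suc n])"
    by (rule multiset_eqI) (simp only: count_mset_map_upt card)
  then have "map f [1..<Suc n] = map g [1..<Suc n]"
    using properties_for_sort[of "map f [1..<Suc n]" "map g [1..<Suc n]", OF _ sorted[of f]]
      properties_for_sort[of "map g [1..<Suc n]" "map g [1..<Suc n]", OF _ sorted[of g]] f g by simp
  then show ?thesis using i by (auto simp del: upt_Suc simp: map_eq_conv)
qed

text \<open>Several indices may carry the same word. The rank numbers the copies, so that word and
  rank together identify the index; this is what allows a permutation to be rebuilt from a multiset
  of words.\<close>

definition fibre_rank :: "(nat \<Rightarrow> 'a) \<Rightarrow> nat \<Rightarrow> nat" where
  "fibre_rank W i = card {j. 1 \<le> j \<and> j < i \<and> W j = W i}"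

lemma fibre_rank_less:
  assumes "1 \<le> i" "i < j" "W i = W j"
  shows "fibre_rank W i < fibre_rank W j"
  unfolding fibre_rank_def using assms by (intro psubset_card_mono) auto

lemma fibre_rank_less_card:
  assumes "i \<in> {1..n}"
  shows "fibre_rank W i < card {j \<in> {1..n}. W j = W i}"
  unfolding fibre_rank_def using assms by (intro psubset_card_mono) auto

lemma bij_betw_fibre_rank:
  assumes N: "\<And>w. card {i \<in> {1..n}. W i = w} = N w"
  shows "bij_betw (\<lambda>i. (W i, fibre_rank W i)) {1..n} {(w, k). k < N w}"
proof -
  have inj: "inj_on (\<lambda>i. (W i, fibre_rank W i)) {1..n}"
  proof (rule inj_onI)
    fix i j assume "i \<in> {1..n}" "j \<in> {1..n}" "(W i, fibre_rank W i) = (W j, fibre_rank W j)"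
    then show "i = j"
      using fibre_rank_less[of i j W] fibre_rank_less[of j i W] by (cases i j rule: linorder_cases) auto
  qed
  have sub: "(\<lambda>i. (W i, fibre_rank W i)) ` {1..n} \<subseteq> {(w, k). k < N w}"
    using fibre_rank_less_card[of _ n W] N by auto
  have eq: "{(w, k). k < N w} = Sigma (W ` {1..n}) (\<lambda>w. {..<N w})"
  proof -
    have "w \<in> W ` {1..n}" if "k < N w" for w k
    proof -
      have "card {i \<in> {1..n}. W i = w} \<noteq> 0" using that N[of w] by simp
      then have "{i \<in> {1..n}. W i = w} \<noteq> {}" by (metis card.empty)
      then show ?thesis by blast
    qed
    then show ?thesis by auto
  qed
  have "card {(w, k). k < N w} = (\<Sum>w\<in>W ` {1..n}. N w)"
    unfolding eq by simp
  also have "\<dots> = card {1..n}"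
    unfolding N[symmetric] using sum.image_gen[of "{1..n}" "\<lambda>_. 1 :: nat" W] by simp
  finally have "(\<lambda>i. (W i, fibre_rank W i)) ` {1..n} = {(w, k). k < N w}"
    using card_image[OF inj] by (intro card_subset_eq sub) (simp_all add: eq)
  with inj show ?thesis by (simp add: bij_betw_def)
qed

section \<open>Itineraries and primitive words\<close>

definition words :: "nat \<Rightarrow> nat \<Rightarrow> nat list set" where
  "words m L = {w. length w = m \<and> set w \<subseteq> {..<L}}"

definition primitive :: "nat list \<Rightarrow> bool" where
  "primitive w \<longleftrightarrow> (\<forall>j. 0 < j \<and> j < length w \<longrightarrow> rotate j w \<noteq> w)"

text \<open>
  A multiset of primitive necklaces of length \<open>m\<close> is encoded by its multiplicity function on words,
  which is rotation invariant. The composition \<open>a\<close> prescribes the total number of occurrences of each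
  letter; by rotation invariance it suffices to count first letters.
\<close>

definition necklace_multisets :: "nat \<Rightarrow> nat list \<Rightarrow> (nat list \<Rightarrow> nat) set" where
  "necklace_multisets m a = {N.
     (\<forall>w. N w \<noteq> 0 \<longrightarrow> w \<in> words m (length a) \<and> primitive w) \<and>
     (\<forall>w. N (rotate1 w) = N w) \<and>
     (\<forall>k<length a. (\<Sum>w | w \<in> words m (length a) \<and> hd w = k. N w) = a ! k)}"

text \<open>The condition that all cycles have length \<open>m\<close>, expressed by iterates
  because itineraries are built from iterates; \<open>uniform_perms_eq_cycles\<close> translates it
  into sizes of orbits.\<close>

definition uniform_perms :: "nat \<Rightarrow> nat \<Rightarrow> (nat \<Rightarrow> nat) set" where
  "uniform_perms m n = {p. p permutes {1..n} \<and>
     (\<forall>i\<in>{1..n}. (p ^^ m) i = i \<and> (\<forall>j. 0 < j \<and> j < m \<longrightarrow> (p ^^ j) i \<noteq> i))}"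

definition increasing_on_fibres :: "nat \<Rightarrow> (nat \<Rightarrow> nat) \<Rightarrow> (nat \<Rightarrow> nat) \<Rightarrow> bool" where
  "increasing_on_fibres n c p \<longleftrightarrow> (\<forall>i j. 1 \<le> i \<and> i < j \<and> j \<le> n \<and> c i = c j \<longrightarrow> p i < p j)"

definition itinerary :: "nat \<Rightarrow> (nat \<Rightarrow> nat) \<Rightarrow> (nat \<Rightarrow> nat) \<Rightarrow> nat \<Rightarrow> nat list" where
  "itinerary m c p i = map (\<lambda>j. c ((p ^^ j) i)) [0..<m]"

lemma finite_words [simp]: "finite (words m L)"
  unfolding words_def using finite_lists_length_eq[of "{..<L}" m] by (simp add: conj_commute)

lemma length_itinerary [simp]: "length (itinerary m c p i) = m"
  by (simp add: itinerary_def)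

lemma hd_itinerary: "m > 0 \<Longrightarrow> hd (itinerary m c p i) = c i"
  by (simp add: itinerary_def hd_map)

lemma permutes_funpow_in:
  assumes "p permutes A" "i \<in> A"
  shows "(p ^^ j) i \<in> A"
  using assms(2) permutes_in_image[OF assms(1)] by (induction j) auto

text \<open>The periodicity \<open>(p ^^ m) i = i\<close> brings the first letter back as the new
  last one.\<close>

lemma itinerary_apply:
  assumes "(p ^^ m) i = i"
  shows "itinerary m c p (p i) = rotate1 (itinerary m c p i)"
proof (rule nth_equalityI)
  fix k assume "k < length (itinerary m c p (p i))"
  then have k: "k < m" by simp
  have "(p ^^ k) (p i) = (p ^^ Suc k) i"
    by (simp add: funpow_swap1)
  also have "\<dots> = (p ^^ (Suc k mod m)) i"
    using assms k by (cases "Suc k = m") auto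
  finally show "itinerary m c p (p i) ! k = rotate1 (itinerary m c p i) ! k"
    using k by (simp add: itinerary_def nth_rotate1)
qed simp

text \<open>A tie in the first letter is broken by the images, whose order
  \<open>increasing_on_fibres\<close> preserves. The length \<open>m\<close> is not tied to the
  cycles of \<open>p\<close> here, so induction on it can peel off one letter.\<close>

lemma itinerary_mono:
  assumes p: "p permutes {1..n}" and c: "\<And>i j. 1 \<le> i \<Longrightarrow> i \<le> j \<Longrightarrow> j \<le> n \<Longrightarrow> c i \<le> c j"
    and inc: "increasing_on_fibres n c p" and "1 \<le> i" "i \<le> j" "j \<le> n"
  shows "itinerary m c p i \<le> itinerary m c p j"
  using assms(4-6)
proof (induction m arbitrary: i j)
  case 0
  then show ?case by (simp add: itinerary_def)
next
  case (Suc m)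
  have Cons: "itinerary (Suc m) c p i = c i # itinerary m c p (p i)" for i
    unfolding itinerary_def by (simp only: upt_conv_Cons[of 0 "Suc m"] map_Suc_upt[symmetric])
      (simp add: funpow_swap1 o_def)
  show ?case
  proof (cases "i = j \<or> c i < c j")
    case False
    then have ij: "i < j" "c i = c j"
      using Suc.prems c[of i j] by auto
    have "p i < p j"
      using ij Suc.prems inc by (auto simp: increasing_on_fibres_def)
    moreover have "p i \<in> {1..n}" "p j \<in> {1..n}"
      using Suc.prems permutes_in_image[OF p] by auto
    ultimately show ?thesis
      unfolding Cons using Suc.IH[of "p i" "p j"] ij by simp
  qed (auto simp: Cons)
qed

lemma uniform_permsD:
  assumes "p \<in> uniform_perms m n"
  shows "p permutes {1..n}" "i \<in> {1..n} \<Longrightarrow> (p ^^ m) i = i"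
    "i \<in> {1..n} \<Longrightarrow> 0 < j \<Longrightarrow> j < m \<Longrightarrow> (p ^^ j) i \<noteq> i"
  using assms by (auto simp: uniform_perms_def)

lemma itinerary_funpow:
  assumes "p \<in> uniform_perms m n" "i \<in> {1..n}"
  shows "itinerary m c p ((p ^^ j) i) = rotate j (itinerary m c p i)"
proof (induction j)
  case (Suc j)
  then show ?case
    using itinerary_apply[of m p "(p ^^ j) i" c] uniform_permsD(2)[OF assms(1)]
      permutes_funpow_in[OF uniform_permsD(1)[OF assms(1)] assms(2)] by simp
qed simp

text \<open>
  If the itinerary had period \<open>t < m\<close>, then \<open>p ^^ t\<close> would be a strictly increasing map of a finite
  fibre into itself without fixed point.
\<close>

lemma primitive_itinerary:
  assumes p: "p \<in> uniform_perms m n" and inc: "increasing_on_fibres n c p" and "i \<in> {1..n}" and "m > 0"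
  shows "primitive (itinerary m c p i)"
  unfolding primitive_def
proof (intro allI impI notI)
  let ?W = "itinerary m c p"
  fix t assume t: "0 < t \<and> t < length (?W i)" and rot: "rotate t (?W i) = ?W i"
  define q where "q = p ^^ t"
  define K where "K = {j \<in> {1..n}. ?W j = ?W i}"
  note perm = uniform_permsD(1)[OF p]
  have p_less: "p j < p k" if "j \<in> {1..n}" "k \<in> {1..n}" "?W j = ?W k" "j < k" for j k
  proof -
    have "c j = c k" using hd_itinerary[OF \<open>m > 0\<close>] that(3) by metis
    then show ?thesis using that inc by (auto simp: increasing_on_fibres_def)
  qed
  have pow_less: "(p ^^ s) j < (p ^^ s) k" if "j \<in> {1..n}" "k \<in> {1..n}" "?W j = ?W k" "j < k" for j k s
  proof (induction s)
    case (Suc s)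
    then show ?case
      using that by (auto intro!: p_less simp: itinerary_funpow[OF p] permutes_funpow_in[OF perm, simplified])
  qed (use that in simp)
  have qK: "q j \<in> K" if "j \<in> K" for j
    using that itinerary_funpow[OF p, of j c t] rot permutes_funpow_in[OF perm, of j t]
    by (auto simp: K_def q_def)
  have q_less: "q j < q k" if "j \<in> K" "k \<in> K" "j < k" for j k
    using pow_less[of j k t] that by (simp add: K_def q_def)
  have iK: "i \<in> K" using assms by (simp add: K_def)
  have powK: "(q ^^ s) i \<in> K" for s
    using iK qK by (induction s) auto
  have ne: "q i \<noteq> i"
    using uniform_permsD(3)[OF p assms(3), of t] t by (simp add: q_def)
  have qm: "(q ^^ m) i = i"
  proof -
    have "(q ^^ m) i = ((p ^^ m) ^^ t) i"
      by (simp add: q_def funpow_mult mult.commute)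
    also have "\<dots> = i"
      using uniform_permsD(2)[OF p assms(3)] by (induction t) auto
    finally show ?thesis .
  qed
  show False
  proof (cases "i < q i")
    case True
    have "i < (q ^^ Suc s) i" for s
    proof (induction s)
      case (Suc s)
      then have "q i < q ((q ^^ Suc s) i)" by (intro q_less iK powK)
      then show ?case using True by simp
    qed (use True in simp)
    from this[of "m - 1"] qm \<open>m > 0\<close> show False by simp
  next
    case False
    with ne have less: "q i < i" by simp
    have "(q ^^ Suc s) i < i" for s
    proof (induction s)
      case (Suc s)
      then have "q ((q ^^ Suc s) i) < q i" by (intro q_less iK powK)
      then show ?case using less by simp
    qed (use less in simp)
    from this[of "m - 1"] qm \<open>m > 0\<close> show False by simp
  qed
qed

text \<open>Rotation invariance holds because \<open>p\<close> maps the indices with itinerary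
  \<open>w\<close> bijectively onto those with itinerary \<open>rotate1 w\<close>. The letter counts
  are right because the itinerary of \<open>i\<close> starts with \<open>c i\<close>.\<close>

lemma necklace_multiset_of_perm:
  assumes p: "p \<in> uniform_perms m n" and inc: "increasing_on_fibres n c p" and "m > 0"
    and c_less: "\<And>i. i \<in> {1..n} \<Longrightarrow> c i < length a"
    and content: "\<And>k. k < length a \<Longrightarrow> card {i \<in> {1..n}. c i = k} = a ! k"
  shows "(\<lambda>w. card {i \<in> {1..n}. itinerary m c p i = w}) \<in> necklace_multisets m a"
proof -
  let ?W = "itinerary m c p"
  note perm = uniform_permsD(1)[OF p]
  have W_words: "?W i \<in> words m (length a)" if "i \<in> {1..n}" for i
    using that c_less permutes_funpow_in[OF perm] by (auto simp: words_def itinerary_def)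
  have supp: "w \<in> words m (length a) \<and> primitive w" if "card {i \<in> {1..n}. ?W i = w} \<noteq> 0" for w
  proof -
    have "{i \<in> {1..n}. ?W i = w} \<noteq> {}" using that by (metis card.empty)
    then show ?thesis
      using W_words primitive_itinerary[OF p inc _ \<open>m > 0\<close>] by auto
  qed
  have rot: "card {i \<in> {1..n}. ?W i = rotate1 w} = card {i \<in> {1..n}. ?W i = w}" for w
  proof -
    have "p ` {i \<in> {1..n}. ?W i = w} = {i \<in> {1..n}. ?W i = rotate1 w}"
    proof (intro equalityI subsetI)
      fix i assume "i \<in> p ` {i \<in> {1..n}. ?W i = w}"
      then show "i \<in> {i \<in> {1..n}. ?W i = rotate1 w}"
        using itinerary_apply[OF uniform_permsD(2)[OF p]] permutes_in_image[OF perm] by auto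
    next
      fix i assume i: "i \<in> {i \<in> {1..n}. ?W i = rotate1 w}"
      then obtain j where j: "j \<in> {1..n}" "i = p j"
        using permutes_image[OF perm] by blast
      then have "rotate1 (?W j) = rotate1 w"
        using i itinerary_apply[OF uniform_permsD(2)[OF p j(1)]] by simp
      then show "i \<in> p ` {i \<in> {1..n}. ?W i = w}"
        using j injD[OF inj_rotate1] by blast
    qed
    then show ?thesis
      using card_image[OF permutes_inj_on[OF perm]] by metis
  qed
  have "(\<Sum>w | w \<in> words m (length a) \<and> hd w = k. card {i \<in> {1..n}. ?W i = w}) = a ! k"
    if "k < length a" for k
  proof -
    let ?S = "{i \<in> {1..n}. c i = k}" and ?T = "{w. w \<in> words m (length a) \<and> hd w = k}"
    have "(\<Sum>w\<in>?T. card {i \<in> {1..n}. ?W i = w}) = (\<Sum>w\<in>?T. card {i \<in> ?S. ?W i = w})"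
      using hd_itinerary[OF \<open>m > 0\<close>] by (intro sum.cong refl arg_cong[where f = card]) auto
    also have "\<dots> = (\<Sum>w\<in>?T. sum (\<lambda>_. 1) {i \<in> ?S. ?W i = w})"
      by simp
    also have "\<dots> = sum (\<lambda>_. 1) ?S"
      by (rule sum.group) (use W_words hd_itinerary[OF \<open>m > 0\<close>] in auto)
    finally show ?thesis using content[OF that] by simp
  qed
  note cont = this
  show ?thesis
    unfolding necklace_multisets_def mem_Collect_eq
    by (intro conjI allI impI)
      (erule supp[THEN conjunct1] | erule supp[THEN conjunct2] | rule rot | erule cont)+
qed

text \<open>Both families of itineraries are sorted, hence agree index by index. It remains to see
  that the itineraries determine the permutation, which is done at the first index where the two
  would differ.\<close>

lemma perm_eq_of_necklace_multiset_eq: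
  assumes p: "p \<in> uniform_perms m n" "increasing_on_fibres n c p"
    and q: "q \<in> uniform_perms m n" "increasing_on_fibres n c q"
    and "m > 0" and c: "\<And>i j. 1 \<le> i \<Longrightarrow> i \<le> j \<Longrightarrow> j \<le> n \<Longrightarrow> c i \<le> c j"
    and eq: "\<And>w. card {i \<in> {1..n}. itinerary m c p i = w} = card {i \<in> {1..n}. itinerary m c q i = w}"
  shows "p = q"
proof -
  let ?W = "itinerary m c p"
  note pp = uniform_permsD(1)[OF p(1)] and qp = uniform_permsD(1)[OF q(1)]
  have W_eq: "?W i = itinerary m c q i" if "i \<in> {1..n}" for i
    by (rule mono_eq_of_card_fibres[where n = n])
      (use itinerary_mono[OF pp c p(2)] itinerary_mono[OF qp c q(2)] eq that in auto)
  \<comment> \<open>At a first difference with \<open>f i < g i\<close>, the value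
    \<open>f i\<close> is taken by \<open>g\<close> at some \<open>j\<close>, and \<open>j\<close>
    has the same itinerary as \<open>i\<close>. If \<open>i \<le> j\<close>, monotonicity of
    \<open>g\<close> on the fibre gives \<open>g i \<le> f i\<close>; if \<open>j < i\<close>, then
    \<open>f j = g j = f i\<close> contradicts injectivity.\<close>
  have no_less: False if "i \<in> {1..n}" "\<And>j. j < i \<Longrightarrow> f j = g j" "f i < g i"
    and f: "f \<in> uniform_perms m n" and g: "g \<in> uniform_perms m n" "increasing_on_fibres n c g"
    and W: "\<And>i. i \<in> {1..n} \<Longrightarrow> itinerary m c f i = itinerary m c g i" for f g i
  proof -
    note fp = uniform_permsD(1)[OF f] and gp = uniform_permsD(1)[OF g(1)]
    have "f i \<in> {1..n}" using that(1) permutes_in_image[OF fp] by simp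
    then obtain j where j: "j \<in> {1..n}" "g j = f i"
      using permutes_image[OF gp] by (metis imageE)
    have "rotate1 (itinerary m c g j) = itinerary m c g (g j)"
      using itinerary_apply[OF uniform_permsD(2)[OF g(1) j(1)]] by simp
    also have "\<dots> = itinerary m c f (f i)"
      using W[OF \<open>f i \<in> {1..n}\<close>] j by simp
    also have "\<dots> = rotate1 (itinerary m c g i)"
      using itinerary_apply[OF uniform_permsD(2)[OF f that(1)]] W[OF that(1)] by simp
    finally have "itinerary m c g j = itinerary m c g i"
      using injD[OF inj_rotate1] by blast
    then have cj: "c j = c i"
      using hd_itinerary[OF \<open>m > 0\<close>] by metis
    have "j < i"
    proof (rule ccontr)
      assume "\<not> j < i"
      then have "g i \<le> g j"
        using g(2) cj that(1) j(1) by (cases "i = j") (auto simp: increasing_on_fibres_def intro!: less_imp_le)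
      then show False using j that(3) by simp
    qed
    then have "f j = f i" using that(2) j by simp
    then show False using \<open>j < i\<close> permutes_inj[OF fp] by (metis injD less_irrefl)
  qed
  have "p i = q i" for i
  proof (induction i rule: less_induct)
    case (less i)
    show ?case
    proof (cases "i \<in> {1..n}")
      case True
      show ?thesis
        using no_less[of i p q, OF True less _ p(1) q W_eq] no_less[of i q p, OF True less[symmetric] _ q(1) p W_eq[symmetric]]
        by (cases "p i" "q i" rule: linorder_cases) auto
    next
      case False
      then show ?thesis using pp qp by (auto simp: permutes_not_in)
    qed
  qed
  then show ?thesis by blast
qed

lemma append_less_append_same_length:
  fixes u v :: "'a :: linorder list"
  assumes "length u = length v" "u < v"
  shows "u @ x < v @ y"
  using assms by (induction u v rule: list_induct2) auto

text \<open>The words, repeated according to \<open>N\<close>, are sorted into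
  \<open>W 1, ..., W n\<close>. Then \<open>p\<close> sends each copy of a word \<open>w\<close> to
  the copy of \<open>rotate1 w\<close> with the same rank, which exists because \<open>N\<close> is
  rotation invariant.\<close>

lemma perm_of_necklace_multiset:
  assumes N: "N \<in> necklace_multisets m a" and "m > 0"
    and c: "\<And>i j. 1 \<le> i \<Longrightarrow> i \<le> j \<Longrightarrow> j \<le> n \<Longrightarrow> c i \<le> c j"
    and c_less: "\<And>i. i \<in> {1..n} \<Longrightarrow> c i < length a"
    and content: "\<And>k. k < length a \<Longrightarrow> card {i \<in> {1..n}. c i = k} = a ! k"
  shows "\<exists>p\<in>uniform_perms m n. increasing_on_fibres n c p \<and>
    (\<forall>w. card {i \<in> {1..n}. itinerary m c p i = w} = N w)"
proof -
  let ?L = "length a"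
  have supp: "w \<in> words m ?L" "primitive w" if "N w \<noteq> 0" for w
    using N that by (auto simp: necklace_multisets_def)
  have rot: "N (rotate1 w) = N w" for w
    using N by (auto simp: necklace_multisets_def)
  have cont: "(\<Sum>w | w \<in> words m ?L \<and> hd w = k. N w) = a ! k" if "k < ?L" for k
    using N that by (auto simp: necklace_multisets_def)
  have hd_less: "hd w < ?L" if "w \<in> words m ?L" for w
    using that \<open>m > 0\<close> by (cases w) (auto simp: words_def)
  have total: "(\<Sum>w\<in>words m ?L. N w) = n"
  proof -
    have "(\<Sum>w\<in>words m ?L. N w) = (\<Sum>k<?L. \<Sum>w | w \<in> words m ?L \<and> hd w = k. N w)"
      by (rule sum.group[symmetric]) (use hd_less in auto)
    also have "\<dots> = (\<Sum>k<?L. card {i \<in> {1..n}. c i = k})"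
      using cont content by simp
    also have "\<dots> = (\<Sum>k<?L. sum (\<lambda>_. 1) {i \<in> {1..n}. c i = k})"
      by simp
    also have "\<dots> = sum (\<lambda>_. 1) {1..n}"
      by (rule sum.group) (use c_less in auto)
    finally show ?thesis by simp
  qed
  define M where "M = Abs_multiset N"
  have "finite {w. N w > 0}"
    by (rule finite_subset[OF _ finite_words[of m ?L]]) (use supp in auto)
  then have count_M: "count M = N"
    by (simp add: M_def)
  define xs where "xs = sorted_list_of_multiset M"
  have xs: "sorted xs" "mset xs = M" by (simp_all add: xs_def)
  have "length xs = size M" using xs by (metis size_mset)
  also have "size M = (\<Sum>w\<in>words m ?L. N w)"
    unfolding size_multiset_overloaded_eq count_M
    by (rule sum.mono_neutral_left) (use supp count_M in \<open>auto simp: not_in_iff set_mset_def\<close>)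
  finally have len: "length xs = n" using total by simp
  define W where "W i = xs ! (i - 1)" for i
  have "map W [1..<Suc n] = xs"
    by (rule nth_equalityI) (simp_all add: len W_def del: upt_Suc)
  then have W_card: "card {i \<in> {1..n}. W i = w} = N w" for w
    using count_mset_map_upt[of W n w] xs(2) count_M by simp
  have W_mono: "W i \<le> W j" if "1 \<le> i" "i \<le> j" "j \<le> n" for i j
    using that sorted_nth_mono[OF xs(1), of "i - 1" "j - 1"] len by (simp add: W_def)
  have W_supp: "N (W i) \<noteq> 0" if "i \<in> {1..n}" for i
    using that by (auto simp: W_card[symmetric])
  have W_words: "W i \<in> words m ?L" "primitive (W i)" "length (W i) = m" if "i \<in> {1..n}" for i
    using supp[OF W_supp[OF that]] by (auto simp: words_def)

  define \<theta> where "\<theta> i = (W i, fibre_rank W i)" for i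
  have \<theta>: "bij_betw \<theta> {1..n} {(w, k). k < N w}"
    unfolding \<theta>_def by (rule bij_betw_fibre_rank[OF W_card])
  define p where "p i = (if i \<in> {1..n} then inv_into {1..n} \<theta> (rotate1 (W i), fibre_rank W i) else i)" for i
  have p: "p i \<in> {1..n}" "W (p i) = rotate1 (W i)" "fibre_rank W (p i) = fibre_rank W i"
    if i: "i \<in> {1..n}" for i
  proof -
    have "\<theta> i \<in> {(w, k). k < N w}"
      using bij_betwE[OF \<theta>] i by (rule bspec)
    then have mem: "(rotate1 (W i), fibre_rank W i) \<in> \<theta> ` {1..n}"
      using \<theta> by (simp add: bij_betw_def \<theta>_def rot)
    show "p i \<in> {1..n}"
      using i inv_into_into[OF mem] by (simp add: p_def)
    have "\<theta> (p i) = (rotate1 (W i), fibre_rank W i)"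
      using i f_inv_into_f[OF mem] by (simp add: p_def)
    then show "W (p i) = rotate1 (W i)" "fibre_rank W (p i) = fibre_rank W i"
      by (simp_all add: \<theta>_def)
  qed
  have \<theta>_inj: "i = j" if "i \<in> {1..n}" "j \<in> {1..n}" "W i = W j" "fibre_rank W i = fibre_rank W j" for i j
    using inj_onD[OF bij_betw_imp_inj_on[OF \<theta>], of i j] that by (simp add: \<theta>_def)
  have "inj_on p {1..n}"
  proof (rule inj_onI)
    fix i j assume i: "i \<in> {1..n}" and j: "j \<in> {1..n}" and eq: "p i = p j"
    have "rotate1 (W i) = rotate1 (W j)"
      using p(2)[OF i] p(2)[OF j] unfolding eq by (rule trans[OF sym])
    moreover have "fibre_rank W i = fibre_rank W j"
      using p(3)[OF i] p(3)[OF j] unfolding eq by (rule trans[OF sym])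
    ultimately show "i = j"
      using injD[OF inj_rotate1] by (blast intro: \<theta>_inj[OF i j])
  qed
  moreover have "p ` {1..n} \<subseteq> {1..n}" using p(1) by blast
  ultimately have "bij_betw p {1..n} {1..n}"
    by (simp add: bij_betw_def endo_inj_surj)
  then have perm: "p permutes {1..n}"
    by (rule bij_imp_permutes) (unfold p_def, simp only: if_False)
  have pow: "W ((p ^^ j) i) = rotate j (W i)" "fibre_rank W ((p ^^ j) i) = fibre_rank W i"
    if i: "i \<in> {1..n}" for i j
    using p permutes_funpow_in[OF perm i] by (induction j) simp_all
  \<comment> \<open>Word and rank determine the index, so \<open>(p ^^ j) i = i\<close> means
    \<open>rotate j (W i) = W i\<close>; primitivity excludes this for
    \<open>0 < j < m\<close>.\<close>
  have unif: "p \<in> uniform_perms m n"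
    unfolding uniform_perms_def
  proof (intro CollectI conjI perm ballI allI impI notI)
    fix i assume i: "i \<in> {1..n}"
    show "(p ^^ m) i = i"
      by (rule \<theta>_inj[OF permutes_funpow_in[OF perm i] i]) (use pow[OF i, of m] W_words(3)[OF i] in simp_all)
    fix j assume "0 < j \<and> j < m" "(p ^^ j) i = i"
    then show False
      using pow(1)[OF i, of j] W_words(2,3)[OF i] unfolding primitive_def by metis
  qed
  \<comment> \<open>Both \<open>c\<close> and the first letters of \<open>W\<close> are monotone,
    and their fibre sizes are prescribed by \<open>a\<close>.\<close>
  have c_hd: "c i = hd (W i)" if i: "i \<in> {1..n}" for i
  proof (rule mono_eq_of_card_fibres[where n = n and f = c and g = "\<lambda>i. hd (W i)"])
    fix i j assume ij: "1 \<le> i" "i \<le> j" "j \<le> n"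
    have "W i \<noteq> []" "W j \<noteq> []"
      using W_words(3)[of i] W_words(3)[of j] ij \<open>m > 0\<close> by auto
    then show "hd (W i) \<le> hd (W j)"
      using W_mono[OF ij] by (cases "W i"; cases "W j") auto
  next
    fix v
    show "card {i \<in> {1..n}. c i = v} = card {i \<in> {1..n}. hd (W i) = v}"
    proof (cases "v < ?L")
      case True
      let ?S = "{i \<in> {1..n}. hd (W i) = v}" and ?T = "{w. w \<in> words m ?L \<and> hd w = v}"
      have "a ! v = (\<Sum>w\<in>?T. card {i \<in> {1..n}. W i = w})"
        unfolding W_card by (rule cont[OF True, symmetric])
      also have "\<dots> = (\<Sum>w\<in>?T. card {i \<in> ?S. W i = w})"
        by (intro sum.cong refl arg_cong[where f = card]) auto
      also have "\<dots> = (\<Sum>w\<in>?T. sum (\<lambda>_. 1) {i \<in> ?S. W i = w})"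
        by simp
      also have "\<dots> = sum (\<lambda>_. 1) ?S"
        by (rule sum.group) (use W_words(1) in auto)
      finally show ?thesis using content[OF True] by simp
    next
      case False
      then have "{i \<in> {1..n}. c i = v} = {}" "{i \<in> {1..n}. hd (W i) = v} = {}"
        using c_less hd_less[OF W_words(1)] by force+
      then show ?thesis by (simp only:)
    qed
  qed (use c i in auto)
  have inc: "increasing_on_fibres n c p"
    unfolding increasing_on_fibres_def
  proof (intro allI impI)
    fix i j assume "1 \<le> i \<and> i < j \<and> j \<le> n \<and> c i = c j"
    then have ij: "i \<in> {1..n}" "j \<in> {1..n}" "i < j" and hd: "hd (W i) = hd (W j)"
      using c_hd[of i] c_hd[of j] by auto
    \<comment> \<open>For equal words the rank decides, and \<open>p\<close> preserves it. For
      different words with the same first letter the order is decided in the tails, which have equal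
      length, so it survives moving the first letter to the end.\<close>
    show "p i < p j"
    proof (cases "W i = W j")
      case True
      have "fibre_rank W (p i) < fibre_rank W (p j)"
        using fibre_rank_less[of i j W] ij True p(3) by simp
      moreover have "\<not> fibre_rank W (p i) < fibre_rank W (p j)" if "p j \<le> p i"
      proof (cases "p i = p j")
        case False
        then show ?thesis
          using that fibre_rank_less[of "p j" "p i" W] p(1)[OF ij(1)] p(1)[OF ij(2)] p(2)[OF ij(1)] p(2)[OF ij(2)] True
          by simp
      qed simp
      ultimately show ?thesis by (meson not_le)
    next
      case False
      with W_mono[of i j] ij have less: "W i < W j" by simp
      obtain x u where u: "W i = x # u" using W_words(3)[OF ij(1)] \<open>m > 0\<close> by (cases "W i") auto
      obtain y v where v: "W j = y # v" using W_words(3)[OF ij(2)] \<open>m > 0\<close> by (cases "W j") auto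
      have "length u = length v" using W_words(3)[OF ij(1)] W_words(3)[OF ij(2)] u v by simp
      moreover have "x = y" "u < v" using less hd u v by auto
      ultimately have "rotate1 (W i) < rotate1 (W j)"
        unfolding u v by (simp add: append_less_append_same_length)
      then have less: "W (p i) < W (p j)"
        unfolding p(2)[OF ij(1)] p(2)[OF ij(2)] .
      show ?thesis
      proof (rule ccontr)
        assume "\<not> p i < p j"
        then have "W (p j) \<le> W (p i)"
          using p(1)[OF ij(1)] p(1)[OF ij(2)] by (intro W_mono) auto
        with less show False by (meson not_le)
      qed
    qed
  qed
  have "itinerary m c p i = W i" if i: "i \<in> {1..n}" for i
  proof (rule nth_equalityI)
    fix k assume "k < length (itinerary m c p i)"
    then have k: "k < m" by simp
    have "c ((p ^^ k) i) = hd (rotate k (W i))"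
      using c_hd[OF permutes_funpow_in[OF perm i]] pow(1)[OF i] by simp
    also have "\<dots> = W i ! k"
      using W_words(3)[OF i] k by (subst hd_rotate_conv_nth) auto
    finally show "itinerary m c p i ! k = W i ! k" using k by (simp add: itinerary_def)
  qed (use W_words(3)[OF i] in simp)
  then have "card {i \<in> {1..n}. itinerary m c p i = w} = N w" for w
    unfolding W_card[symmetric] by (intro arg_cong[where f = card]) auto
  with unif inc show ?thesis by blast
qed

text \<open>
  This is the Gessel-Reutenauer bijection for cycle type \<open>m\<^sup>r\<close>: the fibres of \<open>c\<close> are the
  blocks on which the permutation has to increase.
\<close>

theorem bij_betw_necklace_multisets:
  assumes "m > 0" and c: "\<And>i j. 1 \<le> i \<Longrightarrow> i \<le> j \<Longrightarrow> j \<le> n \<Longrightarrow> c i \<le> c j"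
    and c_less: "\<And>i. i \<in> {1..n} \<Longrightarrow> c i < length a"
    and content: "\<And>k. k < length a \<Longrightarrow> card {i \<in> {1..n}. c i = k} = a ! k"
  shows "bij_betw (\<lambda>p w. card {i \<in> {1..n}. itinerary m c p i = w})
    {p \<in> uniform_perms m n. increasing_on_fibres n c p} (necklace_multisets m a)"
  unfolding bij_betw_def
proof (intro conjI inj_onI equalityI subsetI)
  fix p q
  assume "p \<in> {p \<in> uniform_perms m n. increasing_on_fibres n c p}"
    "q \<in> {p \<in> uniform_perms m n. increasing_on_fibres n c p}"
    "(\<lambda>w. card {i \<in> {1..n}. itinerary m c p i = w}) = (\<lambda>w. card {i \<in> {1..n}. itinerary m c q i = w})"
  then show "p = q"
    by (intro perm_eq_of_necklace_multiset_eq[OF _ _ _ _ \<open>m > 0\<close> c]) (auto dest: fun_cong)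
next
  fix N assume "N \<in> (\<lambda>p w. card {i \<in> {1..n}. itinerary m c p i = w}) `
      {p \<in> uniform_perms m n. increasing_on_fibres n c p}"
  then show "N \<in> necklace_multisets m a"
    using necklace_multiset_of_perm[OF _ _ \<open>m > 0\<close> c_less content] by blast
next
  fix N assume "N \<in> necklace_multisets m a"
  from perm_of_necklace_multiset[OF this \<open>m > 0\<close> c c_less content]
  obtain p where "p \<in> uniform_perms m n" "increasing_on_fibres n c p"
    "\<And>w. card {i \<in> {1..n}. itinerary m c p i = w} = N w"
    by blast
  then show "N \<in> (\<lambda>p w. card {i \<in> {1..n}. itinerary m c p i = w}) `
      {p \<in> uniform_perms m n. increasing_on_fibres n c p}"
    by (intro image_eqI[of _ _ p]) auto
qed

subsection \<open>Power sums and ribbons\<close>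

context
  notes add_2_eq_Suc [simp del] add_2_eq_Suc' [simp del]
begin

text \<open>
  A function \<open>f\<close> on lists stands for the formal power series whose coefficient at the monomial
  \<open>x\<^sub>0 ^ a\<^sub>0 * x\<^sub>1 ^ a\<^sub>1 * \<dots>\<close> is \<open>f a\<close>; then \<open>psum_mult j f\<close> is its product with
  the power sum \<open>p\<^sub>j\<close>.
\<close>

definition psum_mult :: "nat \<Rightarrow> (nat list \<Rightarrow> real) \<Rightarrow> nat list \<Rightarrow> real" where
  "psum_mult j f a = (\<Sum>i<length a. if j \<le> a ! i then f (a[i := a ! i - j]) else 0)"

lemma psum_mult_Nil [simp]: "psum_mult j f [] = 0"
  by (simp add: psum_mult_def)

lemma psum_mult_Cons:
  "psum_mult j f (x # a) = (if j \<le> x then f ((x - j) # a) else 0) + psum_mult j (\<lambda>b. f (x # b)) a"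
  unfolding psum_mult_def length_Cons sum.lessThan_Suc_shift by (simp cong: if_cong)

lemma psum_mult_commute: "psum_mult j (psum_mult k f) = psum_mult k (psum_mult j f)"
proof
  fix a
  define T where "T j i f a = (if j \<le> a ! i then f (a[i := a ! i - j]) else 0)"
    for j i and f :: "nat list \<Rightarrow> real" and a
  have *: "psum_mult j (psum_mult k f) a = (\<Sum>i<length a. \<Sum>i'<length a. T j i (T k i' f) a)" for j k
    by (auto simp: psum_mult_def T_def intro!: sum.cong)
  have "T j i (T k i' f) a = T k i' (T j i f) a" if "i < length a" "i' < length a" for i i'
    using that by (cases "i = i'") (auto simp: T_def list_update_swap add.commute)
  then show "psum_mult j (psum_mult k f) a = psum_mult k (psum_mult j f) a"
    unfolding * by (subst sum.swap) (auto intro!: sum.cong)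
qed

lemma psum_mult_funpow_commute:
  "(psum_mult j ^^ p) ((psum_mult k ^^ q) f) = (psum_mult k ^^ q) ((psum_mult j ^^ p) f)"
proof -
  have *: "psum_mult j ((psum_mult k ^^ q) f) = (psum_mult k ^^ q) (psum_mult j f)" for f
    by (induction q) (simp_all add: psum_mult_commute[of j k])
  show ?thesis
    by (induction p) (simp_all add: *)
qed

lemma psum_mult_add: "psum_mult j (\<lambda>a. f a + g a) a = psum_mult j f a + psum_mult j g a"
  unfolding psum_mult_def sum.distrib[symmetric] by (intro sum.cong) auto

lemma psum_mult_cmult: "psum_mult j (\<lambda>a. c * f a) a = c * psum_mult j f a"
  by (auto simp add: psum_mult_def sum_distrib_left intro!: sum.cong)

lemma psum_mult_sum: "psum_mult j (\<lambda>a. \<Sum>x\<in>X. f x a) a = (\<Sum>x\<in>X. psum_mult j (f x) a)"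
proof (induction X rule: infinite_finite_induct)
  case (insert x F)
  then show ?case by (simp add: psum_mult_add)
qed (simp_all add: psum_mult_def)

lemma psum_mult_funpow_cmult:
  "(psum_mult j ^^ q) (\<lambda>a. c * f a) = (\<lambda>a. c * (psum_mult j ^^ q) f a)"
proof (induction q)
  case (Suc q)
  then show ?case using psum_mult_cmult[of j c "(psum_mult j ^^ q) f"] by auto
qed simp

lemma psum_mult_funpow_sum:
  "(psum_mult j ^^ q) (\<lambda>a. \<Sum>x\<in>X. f x a) = (\<lambda>a. \<Sum>x\<in>X. (psum_mult j ^^ q) (f x) a)"
  by (induction q) (simp_all add: psum_mult_sum[abs_def])

lemma sum_list_update_minus:
  fixes a :: "nat list"
  assumes "i < length a" "j \<le> a ! i"
  shows "sum_list (a[i := a ! i - j]) + j = sum_list a"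
  using assms elem_le_sum_list[of i a] by (simp add: sum_list_update)

text \<open>Multiplication by \<open>p_j\<close> raises the degree by \<open>j\<close>, so only
  values of \<open>f\<close> in the degree lower by \<open>j\<close> enter.\<close>

lemma psum_mult_cong:
  assumes "\<And>b. sum_list b + j = sum_list a \<Longrightarrow> f b = g b"
  shows "psum_mult j f a = psum_mult j g a"
  unfolding psum_mult_def by (intro sum.cong if_cong refl assms sum_list_update_minus) auto

lemma psum_mult_funpow_cong:
  assumes "\<And>b. sum_list b + q * j = sum_list a \<Longrightarrow> f b = g b"
  shows "(psum_mult j ^^ q) f a = (psum_mult j ^^ q) g a"
  using assms
proof (induction q arbitrary: a)
  case (Suc q)
  show ?case
    by (simp, intro psum_mult_cong Suc.IH Suc.prems) auto
qed simp

text \<open>In this range no list has the degree at which \<open>f\<close> would be read, so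
  \<open>f\<close> may be replaced by the zero function.\<close>

lemma psum_mult_funpow_eq_0:
  assumes "sum_list a < q * j"
  shows "(psum_mult j ^^ q) f a = 0"
proof -
  have "(psum_mult j ^^ q) f a = (psum_mult j ^^ q) (\<lambda>a. 0 * f a) a"
    using assms by (intro psum_mult_funpow_cong) auto
  then show ?thesis using psum_mult_funpow_cmult[of q j 0 f] by (simp del: mult_zero_left)
qed

text \<open>What is kept of quasisymmetry: zero exponents may be dropped. It is stated for a single
  degree because for necklace counts it is proved by induction on the degree.\<close>

definition zero_insertion_invariant :: "nat \<Rightarrow> (nat list \<Rightarrow> real) \<Rightarrow> bool" where
  "zero_insertion_invariant n f \<longleftrightarrow>
     (\<forall>xs ys. sum_list xs + sum_list ys = n \<longrightarrow> f (xs @ 0 # ys) = f (xs @ ys))"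

lemma psum_mult_append:
  "psum_mult j f (xs @ ys) = psum_mult j (\<lambda>b. f (b @ ys)) xs + psum_mult j (\<lambda>b. f (xs @ b)) ys"
  by (induction xs arbitrary: f) (simp_all add: psum_mult_Cons)

text \<open>When either half of the list loses \<open>j\<close>, the hypothesis in degree
  \<open>n\<close> applies; the inserted zero itself cannot lose \<open>j > 0\<close>.\<close>

lemma zero_insertion_invariant_psum_mult:
  assumes "zero_insertion_invariant n f" "j > 0"
  shows "zero_insertion_invariant (j + n) (psum_mult j f)"
  unfolding zero_insertion_invariant_def
proof (intro allI impI)
  fix xs ys :: "nat list" assume s: "sum_list xs + sum_list ys = j + n"
  have "psum_mult j (\<lambda>b. f (b @ 0 # ys)) xs = psum_mult j (\<lambda>b. f (b @ ys)) xs"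
    using s assms by (intro psum_mult_cong) (auto simp: zero_insertion_invariant_def)
  moreover have "psum_mult j (\<lambda>b. f (xs @ 0 # b)) ys = psum_mult j (\<lambda>b. f (xs @ b)) ys"
    using s assms by (intro psum_mult_cong) (auto simp: zero_insertion_invariant_def)
  ultimately show "psum_mult j f (xs @ 0 # ys) = psum_mult j f (xs @ ys)"
    using assms(2) by (simp add: psum_mult_append psum_mult_Cons)
qed

lemma zero_insertion_invariant_psum_mult_funpow:
  assumes "zero_insertion_invariant n f" "j > 0"
  shows "zero_insertion_invariant (q * j + n) ((psum_mult j ^^ q) f)"
  using assms by (induction q) (auto simp: add.assoc intro!: zero_insertion_invariant_psum_mult)

section \<open>The ribbon functional\<close>

definition parity_positions :: "bool \<Rightarrow> nat \<Rightarrow> nat set" where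
  "parity_positions e n = {i. 1 \<le> i \<and> i < n \<and> (odd i \<longleftrightarrow> e)}"

text \<open>Through their interior partial sums these lists code the subsets of
  \<open>parity_positions e n\<close> when \<open>n > 0\<close>; see
  \<open>bij_betw_proper_prefix_sums\<close>.\<close>

definition compositions :: "bool \<Rightarrow> nat \<Rightarrow> nat list set" where
  "compositions e n = {a. 0 \<notin> set a \<and> sum_list a = n \<and>
     (\<forall>i. 0 < i \<and> i < length a \<longrightarrow> (odd (sum_list (take i a)) \<longleftrightarrow> e))}"

text \<open>
  The scalar product with the ribbon Schur function whose descent set is \<open>parity_positions e n\<close>,
  expanded by inclusion-exclusion over its subsets: \<open>e = True\<close> describes alternating and
  \<open>e = False\<close> reverse alternating permutations.
\<close>

definition ribbon :: "bool \<Rightarrow> nat \<Rightarrow> (nat list \<Rightarrow> real) \<Rightarrow> real" where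
  "ribbon e n f = (\<Sum>a\<in>compositions e n. (-1) ^ (card (parity_positions e n) + length a + 1) * f a)"

lemma finite_parity_positions [simp]: "finite (parity_positions e n)"
  by (rule finite_subset[of _ "{..<n}"]) (auto simp: parity_positions_def)

lemma card_parity_positions_False: "card (parity_positions False n) = (n - 1) div 2"
proof -
  have "parity_positions False n = (\<lambda>i. 2 * i) ` {1..(n - 1) div 2}"
    by (auto simp: parity_positions_def image_iff elim!: evenE)
  then show ?thesis by (simp add: card_image inj_on_def)
qed

lemma card_parity_positions_True: "card (parity_positions True n) = n div 2"
proof -
  have "parity_positions True n = (\<lambda>i. 2 * i + 1) ` {..<n div 2}"
    by (auto simp: parity_positions_def image_iff elim!: oddE)
  then show ?thesis by (simp add: card_image inj_on_def)
qed

text \<open>Passing from length 0 to length 2 adds no even interior position, hence the restriction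
  to \<open>n > 0\<close>.\<close>

lemma card_parity_positions_add_2:
  assumes "n > 0"
  shows "card (parity_positions e (n + 2)) = card (parity_positions e n) + 1"
  using assms
  by (cases e; cases n) (simp_all add: card_parity_positions_False card_parity_positions_True)

lemma length_le_sum_list:
  fixes a :: "nat list"
  assumes "0 \<notin> set a"
  shows "length a \<le> sum_list a"
  using assms by (induction a) auto

lemma finite_compositions [simp]: "finite (compositions e n)"
proof (rule finite_subset)
  show "compositions e n \<subseteq> {a. set a \<subseteq> {..n} \<and> length a \<le> n}"
    by (auto simp: compositions_def length_le_sum_list member_le_sum_list)
qed (rule finite_lists_length_le, simp)

lemma ribbon_cong:
  assumes "\<And>a. sum_list a = n \<Longrightarrow> f a = g a"
  shows "ribbon e n f = ribbon e n g"
  unfolding ribbon_def by (intro sum.cong refl) (simp add: compositions_def assms)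

lemma ribbon_cmult: "ribbon e n (\<lambda>a. c * f a) = c * ribbon e n f"
  by (simp add: ribbon_def sum_distrib_left mult_ac)

lemma ribbon_sum: "ribbon e n (\<lambda>a. \<Sum>x\<in>X. f x a) = (\<Sum>x\<in>X. ribbon e n (f x))"
  unfolding ribbon_def by (simp add: sum_distrib_left) (rule sum.swap)

lemma sum_list_take_update:
  fixes a :: "nat list"
  assumes "i < length a"
  shows "sum_list (take k (a[i := a ! i + x])) = sum_list (take k a) + (if i < k then x else 0)"
proof (cases "i < k")
  case True
  with assms have "i < length (take k a)" "take k a ! i = a ! i" by auto
  then show ?thesis using True elem_le_sum_list[of i "take k a"]
    by (simp add: take_update_swap sum_list_update)
qed simp

lemma compositions_update_add_2:
  assumes "a \<in> compositions e n" "i < length a"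
  shows "a[i := a ! i + 2] \<in> compositions e (n + 2)"
proof -
  have "sum_list (a[i := a ! i + 2]) = sum_list a + 2"
    using sum_list_take_update[OF assms(2), of "length a" 2] assms(2) by simp
  moreover have "0 \<notin> set (a[i := a ! i + 2])"
    using assms by (auto simp: compositions_def dest!: set_update_subset_insert[THEN subsetD])
  ultimately show ?thesis
    using assms by (auto simp: compositions_def sum_list_take_update)
qed

lemma compositions_update_minus_2:
  assumes "a \<in> compositions e (n + 2)" "i < length a" "a ! i > 2"
  shows "a[i := a ! i - 2] \<in> compositions e n"
proof -
  let ?b = "a[i := a ! i - 2]"
  have eq: "?b[i := ?b ! i + 2] = a" using assms by auto
  have *: "sum_list (take k a) = sum_list (take k ?b) + (if i < k then 2 else 0)" for k
    using sum_list_take_update[of i ?b k 2] assms unfolding eq by simp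
  have "sum_list ?b + 2 = sum_list a"
    using *[of "length a"] assms by simp
  moreover have "0 \<notin> set ?b"
    using assms by (auto simp: compositions_def dest!: set_update_subset_insert[THEN subsetD])
  moreover have "odd (sum_list (take k ?b)) \<longleftrightarrow> odd (sum_list (take k a))" for k
    by (subst *) simp
  ultimately show ?thesis
    using assms by (simp add: compositions_def)
qed

lemma ribbon_psum_mult_eq:
  "ribbon e n (psum_mult j f) =
     (\<Sum>(a, i)\<in>{(a, i). a \<in> compositions e n \<and> i < length a \<and> j \<le> a ! i}.
        (-1) ^ (card (parity_positions e n) + length a + 1) * f (a[i := a ! i - j]))"
proof -
  let ?s = "\<lambda>a. (-1) ^ (card (parity_positions e n) + length a + 1) :: real"
  have "ribbon e n (psum_mult j f) =
      (\<Sum>a\<in>compositions e n. \<Sum>i | i < length a \<and> j \<le> a ! i. ?s a * f (a[i := a ! i - j]))"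
    unfolding ribbon_def psum_mult_def
    by (intro sum.cong refl) (simp add: sum_distrib_left sum.If_cases Int_def)
  also have "\<dots> = (\<Sum>(a, i)\<in>Sigma (compositions e n) (\<lambda>a. {i. i < length a \<and> j \<le> a ! i}).
      ?s a * f (a[i := a ! i - j]))"
    by (subst sum.Sigma) auto
  finally show ?thesis
    by (simp add: Sigma_def, intro sum.cong) auto
qed

text \<open>Subtracting 2 from the marked part is a bijection between the pairs
  \<open>(a, i)\<close> of the two sides. The part stays positive because \<open>j > 0\<close>, and
  \<open>f\<close> is evaluated at the same list.\<close>

lemma ribbon_psum_mult_add_2:
  assumes "j > 0"
  shows "ribbon e (n + j + 2) (psum_mult (j + 2) f) = - ribbon e (n + j) (psum_mult j f)"
proof -
  have card: "card (parity_positions e (n + j + 2)) = card (parity_positions e (n + j)) + 1"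
    using assms by (intro card_parity_positions_add_2) simp
  have diff: "x - 2 - j = x - (j + 2)" for x
    by simp
  show ?thesis
    unfolding ribbon_psum_mult_eq sum_negf[symmetric]
    by (rule sum.reindex_bij_witness[where j = "\<lambda>(a, i). (a[i := a ! i - 2], i)"
        and i = "\<lambda>(a, i). (a[i := a ! i + 2], i)"])
     (use assms in \<open>auto simp: compositions_update_minus_2 compositions_update_add_2
        card diff simp del: diff_diff_left\<close>)
qed

lemma ribbon_psum_mult_add_even:
  assumes "j > 0"
  shows "ribbon e (n + (j + 2 * i)) (psum_mult (j + 2 * i) f) = (-1) ^ i * ribbon e (n + j) (psum_mult j f)"
proof (induction i)
  case (Suc i)
  then show ?case
    using ribbon_psum_mult_add_2[of "j + 2 * i" e n f] assms by (simp add: add_ac)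
qed simp

lemma ribbon_psum_mult_funpow_add_even:
  assumes "j > 0"
  shows "ribbon e (n + q * (j + 2 * i)) ((psum_mult (j + 2 * i) ^^ q) f) =
           (-1) ^ (q * i) * ribbon e (n + q * j) ((psum_mult j ^^ q) f)"
proof (induction q arbitrary: n f)
  case (Suc q)
  let ?k = "j + 2 * i"
  have "ribbon e (n + Suc q * ?k) ((psum_mult ?k ^^ Suc q) f) =
      ribbon e ((n + q * ?k) + ?k) (psum_mult ?k ((psum_mult ?k ^^ q) f))"
    by (simp add: add_ac)
  also have "\<dots> = (-1) ^ i * ribbon e ((n + q * ?k) + j) (psum_mult j ((psum_mult ?k ^^ q) f))"
    by (rule ribbon_psum_mult_add_even[OF assms])
  \<comment> \<open>The factor already reduced to \<open>p_j\<close> is moved inside and absorbed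
    into \<open>f\<close>, so that the induction hypothesis applies to the rest.\<close>
  also have "psum_mult j ((psum_mult ?k ^^ q) f) = (psum_mult ?k ^^ q) (psum_mult j f)"
    using psum_mult_funpow_commute[where p = 1] by simp
  also have "n + q * ?k + j = (n + j) + q * ?k" by simp
  also have "ribbon e ((n + j) + q * ?k) ((psum_mult ?k ^^ q) (psum_mult j f)) =
      (-1) ^ (q * i) * ribbon e (n + j + q * j) ((psum_mult j ^^ q) (psum_mult j f))"
    by (rule Suc.IH)
  finally show ?case
    by (simp add: funpow_swap1 power_add add_ac)
qed simp

text \<open>The new part creates one more interior partial sum. Between two parts its parity is that
  of the neighbouring sum; at the front it is 2 and at the end it is \<open>n\<close>, whence the
  two side conditions.\<close>

lemma compositions_insert_2:
  assumes "n > 0"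
  shows "xs @ 2 # ys \<in> compositions e (n + 2) \<longleftrightarrow>
    xs @ ys \<in> compositions e n \<and> (xs = [] \<longrightarrow> \<not> e) \<and> (ys = [] \<longrightarrow> (odd n \<longleftrightarrow> e))"
proof -
  let ?a = "xs @ 2 # ys" and ?b = "xs @ ys"
  have le: "sum_list (take i ?a) = sum_list (take i ?b)" if "i \<le> length xs" for i
    using that by simp
  have gt: "sum_list (take (Suc i) ?a) = sum_list (take i ?b) + 2" if "i \<ge> length xs" for i
    using that by (simp add: Suc_diff_le)
  have "(\<forall>i. 0 < i \<and> i < length ?a \<longrightarrow> (odd (sum_list (take i ?a)) \<longleftrightarrow> e)) \<longleftrightarrow>
      (\<forall>i. 0 < i \<and> i < length ?b \<longrightarrow> (odd (sum_list (take i ?b)) \<longleftrightarrow> e)) \<and>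
      (xs = [] \<longrightarrow> \<not> e) \<and> (ys = [] \<longrightarrow> (odd n \<longleftrightarrow> e))" (is "?A \<longleftrightarrow> ?B")
    if s: "sum_list ?b = n"
  proof
    assume A: ?A
    show ?B
    proof (intro conjI allI impI)
      fix i assume i: "0 < i \<and> i < length ?b"
      show "odd (sum_list (take i ?b)) \<longleftrightarrow> e"
      proof (cases "i \<le> length xs")
        case True
        then show ?thesis using A[rule_format, of i] i le[of i] by simp
      next
        case False
        then show ?thesis using A[rule_format, of "Suc i"] i gt[of i] by simp
      qed
    next
      assume "xs = []"
      then show "\<not> e" using A[rule_format, of 1] assms s by (cases ys) auto
    next
      assume "ys = []"
      then show "odd n \<longleftrightarrow> e" using A[rule_format, of "length xs"] assms s by (cases xs) auto
    qed
  next
    assume B: ?B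
    show ?A
    proof (intro allI impI)
      fix i assume i: "0 < i \<and> i < length ?a"
      show "odd (sum_list (take i ?a)) \<longleftrightarrow> e"
      proof (cases "i \<le> length xs")
        case True
        show ?thesis
        proof (cases "ys = [] \<and> i = length xs")
          case True
          then show ?thesis using B s by simp
        next
          case False
          then have "i < length ?b" using True by (cases ys) auto
          then show ?thesis using B i le[OF True] by metis
        qed
      next
        case False
        then obtain k where k: "i = Suc k" "k \<ge> length xs" by (cases i) auto
        show ?thesis
        proof (cases "k = 0")
          case True
          then show ?thesis using B k by simp
        next
          case False
          then have "0 < k \<and> k < length ?b" using i k by simp
          then show ?thesis using B gt[OF k(2)] k(1) by (metis even_add even_numeral)
        qed
      qed
    qed
  qed
  then show ?thesis by (auto simp: compositions_def)
qed

lemma compositions_pos_length: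
  assumes "a \<in> compositions e n" "n > 0"
  shows "length a > 0"
  using assms by (auto simp: compositions_def)

text \<open>
  A preimage of \<open>b\<close> under removal of a part \<open>2\<close> either enlarges one of the \<open>length b\<close> parts or
  inserts a new part; the two kinds have opposite signs and almost cancel.
\<close>

lemma ribbon_psum_mult_2:
  assumes "n > 0" and f: "zero_insertion_invariant n f"
  shows "ribbon e (n + 2) (psum_mult 2 f) =
           (of_bool (\<not> e) + of_bool (odd n \<longleftrightarrow> e) - 1) * ribbon e n f"
proof -
  let ?s = "\<lambda>n a. (-1) ^ (card (parity_positions e n) + length a + 1) :: real"
  let ?P = "{(a, i). a \<in> compositions e (n + 2) \<and> i < length a \<and> 2 \<le> a ! i}"
  let ?P1 = "{(a, i). a \<in> compositions e (n + 2) \<and> i < length a \<and> 2 < a ! i}"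
  let ?P2 = "{(a, i). a \<in> compositions e (n + 2) \<and> i < length a \<and> a ! i = 2}"
  let ?h = "\<lambda>(a, i). ?s (n + 2) a * f (a[i := a ! i - 2])"
  let ?C = "compositions e n"
  \<comment> \<open>The gaps of \<open>b\<close> that can receive a part 2. All inner gaps qualify,
    the outer ones under the conditions of \<open>compositions_insert_2\<close>.\<close>
  let ?J = "\<lambda>b :: nat list. {i. i \<le> length b \<and> (i = 0 \<longrightarrow> \<not> e) \<and> (i = length b \<longrightarrow> (odd n \<longleftrightarrow> e))}"
  have fin: "finite ?P1" "finite ?P2"
    by (rule finite_subset[of _ "Sigma (compositions e (n + 2)) (\<lambda>a. {..<length a})"]; auto)+
  have s2: "?s (n + 2) a = - ?s n a" for a :: "nat list"
    using card_parity_positions_add_2[OF assms(1), of e] by simp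
  have "?P = ?P1 \<union> ?P2" by auto
  then have "ribbon e (n + 2) (psum_mult 2 f) = sum ?h (?P1 \<union> ?P2)"
    unfolding ribbon_psum_mult_eq by simp
  also have "\<dots> = sum ?h ?P1 + sum ?h ?P2"
    by (rule sum.union_disjoint) (use fin in auto)
  also have "sum ?h ?P1 = (\<Sum>(b, i)\<in>Sigma ?C (\<lambda>b. {..<length b}). - (?s n b * f b))"
    by (rule sum.reindex_bij_witness[where j = "\<lambda>(a, i). (a[i := a ! i - 2], i)"
        and i = "\<lambda>(a, i). (a[i := a ! i + 2], i)"])
      (auto simp: compositions_update_minus_2 compositions_update_add_2 card_parity_positions_add_2[OF assms(1)],
        auto simp: compositions_def in_set_conv_nth)
  also have "sum ?h ?P2 = (\<Sum>(b, i)\<in>Sigma ?C ?J. ?s n b * f b)"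
  proof -
    have A: "take i b @ 2 # drop i b = a \<and> b \<in> ?C \<and> i \<in> ?J b \<and>
        ?s n b * f b = ?s (n + 2) a * f (a[i := a ! i - 2])"
      if a: "a \<in> compositions e (n + 2)" "i < length a" "a ! i = 2"
        and b_def: "b = take i a @ drop (Suc i) a" for a b i
    proof (intro conjI)
      have eq: "take i a @ 2 # drop (Suc i) a = a"
        using a by (metis id_take_nth_drop)
      show "take i b @ 2 # drop i b = a"
        using a eq by (simp add: b_def)
      have b: "b \<in> ?C" "(take i a = [] \<longrightarrow> \<not> e)" "(drop (Suc i) a = [] \<longrightarrow> (odd n \<longleftrightarrow> e))"
        using compositions_insert_2[OF assms(1), of "take i a" "drop (Suc i) a" e] a(1)
        unfolding eq b_def by auto
      then show "b \<in> ?C" by simp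
      show "i \<in> ?J b"
        using b a by (auto simp: b_def)
      have "a[i := a ! i - 2] = take i a @ 0 # drop (Suc i) a"
        using a by (simp add: upd_conv_take_nth_drop)
      moreover have "sum_list (take i a) + sum_list (drop (Suc i) a) = n"
        using b(1) by (simp add: compositions_def b_def)
      \<comment> \<open>This is where the zero left behind by the removed part is dropped.\<close>
      ultimately have "f (a[i := a ! i - 2]) = f b"
        using f by (simp add: zero_insertion_invariant_def b_def)
      moreover have "length a = Suc (length b)"
        using a by (auto simp: b_def)
      ultimately show "?s n b * f b = ?s (n + 2) a * f (a[i := a ! i - 2])"
        unfolding s2 by simp
    qed
    have B: "take i a @ drop (Suc i) a = b \<and> a \<in> compositions e (n + 2) \<and> i < length a \<and> a ! i = 2"
      if b: "b \<in> ?C" "i \<in> ?J b" and a_def: "a = take i b @ 2 # drop i b" for a b i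
      using compositions_insert_2[OF assms(1), of "take i b" "drop i b" e] b
        compositions_pos_length[OF b(1) assms(1)] by (auto simp: nth_append a_def)
    show ?thesis
    proof (rule sum.reindex_bij_witness[where j = "\<lambda>(a, i). (take i a @ drop (Suc i) a, i)"
            and i = "\<lambda>(b, i). (take i b @ 2 # drop i b, i)"], goal_cases)
      case (1 x)
      then obtain a i where "x = (a, i)" "a \<in> compositions e (n + 2)" "i < length a" "a ! i = 2" by blast
      then show ?case using A[of a i, OF _ _ _ refl] by (simp only: prod.case)
    next
      case (2 x)
      then obtain a i where "x = (a, i)" "a \<in> compositions e (n + 2)" "i < length a" "a ! i = 2" by blast
      then show ?case using A[of a i, OF _ _ _ refl] by (simp only: prod.case mem_Sigma_iff)
    next
      case (3 x)
      then obtain b i where "x = (b, i)" "b \<in> ?C" "i \<in> ?J b" by blast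
      then show ?case using B[of b i, OF _ _ refl] by (simp only: prod.case)
    next
      case (4 x)
      then obtain b i where x: "x = (b, i)" and b: "b \<in> ?C" "i \<in> ?J b" by blast
      from B[OF b refl] show ?case by (simp only: x prod.case mem_Collect_eq)
    next
      case (5 x)
      then obtain a i where "x = (a, i)" "a \<in> compositions e (n + 2)" "i < length a" "a ! i = 2" by blast
      then show ?case using A[of a i, OF _ _ _ refl] by (simp only: prod.case)
    qed
  qed
  also have "(\<Sum>(b, i)\<in>Sigma ?C (\<lambda>b. {..<length b}). - (?s n b * f b)) +
      (\<Sum>(b, i)\<in>Sigma ?C ?J. ?s n b * f b) =
      (\<Sum>b\<in>?C. (real (card (?J b)) - real (length b)) * (?s n b * f b))"
    by (subst (1 2) sum.Sigma[symmetric])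
      (auto simp: sum.distrib[symmetric] algebra_simps intro!: sum.cong)
  also have "\<dots> = (\<Sum>b\<in>?C. (of_bool (\<not> e) + of_bool (odd n \<longleftrightarrow> e) - 1) * (?s n b * f b))"
  proof (intro sum.cong refl)
    fix b assume b: "b \<in> ?C"
    have "?J b = {0<..<length b} \<union> (if e then {} else {0}) \<union> (if odd n \<longleftrightarrow> e then {length b} else {})"
      using compositions_pos_length[OF b assms(1)] by auto
    then have "card (?J b) = length b - 1 + of_bool (\<not> e) + of_bool (odd n \<longleftrightarrow> e)"
      using compositions_pos_length[OF b assms(1)] by (auto simp: card_insert_if)
    then show "(real (card (?J b)) - real (length b)) * (?s n b * f b) =
        (of_bool (\<not> e) + of_bool (odd n \<longleftrightarrow> e) - 1) * (?s n b * f b)"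
      using compositions_pos_length[OF b assms(1)] by (simp add: of_nat_diff Suc_le_eq)
  qed
  finally show ?thesis
    by (simp add: ribbon_def sum_distrib_left)
qed

end

subsection \<open>Counting primitive words\<close>

lemma sum_Pow_minus_one_power_card:
  assumes "finite A"
  shows "(\<Sum>X\<in>Pow A. (-1) ^ card X) = (if A = {} then 1 else (0 :: 'a :: comm_ring_1))"
  using prod_diff_conv_sum[OF assms, of "\<lambda>_. 1 :: 'a" "\<lambda>_. 1"] assms by (auto simp: power_0_left)

lemma squarefree_eq_prod_prime_factors:
  fixes d :: nat
  assumes "squarefree d"
  shows "\<Prod>(prime_factors d) = d"
proof -
  have "d \<noteq> 0" using assms by (metis not_squarefree_0)
  then have "d = (\<Prod>p\<in>prime_factors d. p ^ multiplicity p d)"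
    using prod_prime_factors[of d] by simp
  also have "\<dots> = (\<Prod>p\<in>prime_factors d. p)"
    using assms \<open>d \<noteq> 0\<close> by (intro prod.cong) (auto simp: squarefree_factorial_semiring')
  finally show ?thesis by simp
qed

lemma prime_factors_prod_primes:
  fixes S :: "nat set"
  assumes "finite S" "\<And>p. p \<in> S \<Longrightarrow> prime p"
  shows "prime_factors (\<Prod>S) = S"
proof -
  have "prime_factors (\<Prod>S) = (\<Union>p\<in>S. prime_factors p)"
    using assms assms(2)[of 0] by (subst prime_factors_prod) (auto simp: o_def)
  also have "\<dots> = S"
    using assms(2) by (auto simp: prime_prime_factors)
  finally show ?thesis .
qed

text \<open>Only squarefree divisors contribute, and these are the products of the subsets of the
  prime factors of \<open>n\<close>; the sum is therefore the expansion of a power of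
  \<open>1 - 1\<close>.\<close>

lemma sum_moebius_mu:
  assumes "n > 0"
  shows "(\<Sum>d | d dvd n. moebius_mu d) = (if n = 1 then 1 else 0)"
proof -
  have "(\<Sum>d | d dvd n. moebius_mu d) = (\<Sum>d | d dvd n \<and> squarefree d. (-1) ^ card (prime_factors d))"
    using assms by (intro sum.mono_neutral_cong_right) (auto simp: moebius_mu_def)
  also have "\<dots> = (\<Sum>S\<in>Pow (prime_factors n). (-1) ^ card S)"
  proof (rule sum.reindex_bij_witness[where i = "\<lambda>S. \<Prod>S" and j = prime_factors], goal_cases)
    case (1 d)
    then show ?case by (simp add: squarefree_eq_prod_prime_factors)
  next
    case (2 d)
    then show ?case using assms dvd_prime_factors[of n d] by auto
  next
    case (3 S)
    then show ?case by (intro prime_factors_prod_primes) (auto intro: finite_subset)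
  next
    case (4 S)
    then have S: "finite S" "\<And>p. p \<in> S \<Longrightarrow> prime p" "S \<subseteq> prime_factors n"
      by (auto intro: finite_subset)
    have "\<Prod>S dvd \<Prod>(prime_factors n)"
      using S by (intro prod_dvd_prod_subset) auto
    also have "\<dots> dvd (\<Prod>p\<in>prime_factors n. p ^ multiplicity p n)"
      by (intro prod_dvd_prod) (auto simp: prime_factors_multiplicity dvd_power)
    also have "\<dots> = n" using assms prod_prime_factors[of n] by simp
    finally have "\<Prod>S dvd n" .
    moreover have "squarefree (\<Prod>S)"
      using S by (intro squarefree_prod_coprime) (auto intro: primes_coprime squarefree_prime)
    ultimately show ?case by simp
  qed auto
  also have "\<dots> = (if prime_factors n = {} then 1 else 0)"
    by (rule sum_Pow_minus_one_power_card) simp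
  also have "prime_factors n = {} \<longleftrightarrow> n = 1"
    using assms by (auto simp: prime_factorization_empty_iff)
  finally show ?thesis by simp
qed

section \<open>Periods and powers of words\<close>

lemma concat_replicate_commute: "concat (replicate n u) @ u = u @ concat (replicate n u)"
  by (induction n) auto

text \<open>Comparing prefixes, \<open>y\<close> starts with \<open>u\<close>, and the remainder
  commutes with \<open>u\<close> again; by the length hypothesis this ends after \<open>k\<close>
  steps.\<close>

lemma commuting_eq_concat_replicate:
  assumes "y @ u = u @ y" "length y = k * length u"
  shows "y = concat (replicate k u)"
  using assms
proof (induction k arbitrary: y)
  case (Suc k)
  let ?e = "length u"
  have le: "?e \<le> length y" using Suc.prems by simp
  have "take ?e (y @ u) = take ?e (u @ y)" using Suc.prems by simp
  then have "take ?e y = u" using le by simp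
  then have y: "y = u @ drop ?e y" by (metis append_take_drop_id)
  then have "u @ drop ?e y @ u = u @ u @ drop ?e y" using Suc.prems(1) by (metis append.assoc)
  then have "drop ?e y = concat (replicate k u)"
    using Suc.prems by (intro Suc.IH) auto
  then show ?case using y by simp
qed simp

lemma set_concat_replicate: "d > 0 \<Longrightarrow> set (concat (replicate d u)) = set u"
  by auto

lemma length_concat_replicate: "length (concat (replicate d u)) = d * length u"
  by (induction d) auto

lemma count_list_concat_replicate: "count_list (concat (replicate d u)) x = d * count_list u x"
  by (induction d) auto

text \<open>A word fixed by \<open>rotate e\<close>, cut after \<open>e\<close> letters, has two
  commuting factors, so it is a power of the first one.\<close>

lemma bij_betw_concat_replicate:
  assumes "d > 0"
  shows "bij_betw (\<lambda>u. concat (replicate d u)) (words e L) {w \<in> words (d * e) L. rotate e w = w}"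
proof -
  obtain d' where d: "d = Suc d'" using assms by (cases d) auto
  show ?thesis
  proof (rule bij_betw_byWitness[where f' = "take e"])
    show "\<forall>u\<in>words e L. take e (concat (replicate d u)) = u"
      by (auto simp: words_def d)
    show "\<forall>w\<in>{w \<in> words (d * e) L. rotate e w = w}. concat (replicate d (take e w)) = w"
    proof
      fix w assume "w \<in> {w \<in> words (d * e) L. rotate e w = w}"
      then have w: "length w = d * e" "rotate e w = w" by (auto simp: words_def)
      let ?u = "take e w" and ?y = "drop e w"
      have lu: "length ?u = e" using w d by simp
      have "rotate (length ?u) (?u @ ?y) = ?y @ ?u" by (rule rotate_append)
      then have "?y @ ?u = ?u @ ?y" using w lu by simp
      moreover have "length ?y = d' * length ?u" using w lu d by simp
      ultimately have "?y = concat (replicate d' ?u)" by (rule commuting_eq_concat_replicate)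
      then show "concat (replicate d ?u) = w" unfolding d by (metis append_take_drop_id concat.simps(2) replicate_Suc)
    qed
    show "(\<lambda>u. concat (replicate d u)) ` words e L \<subseteq> {w \<in> words (d * e) L. rotate e w = w}"
    proof
      fix w assume "w \<in> (\<lambda>u. concat (replicate d u)) ` words e L"
      then obtain u where u: "length u = e" "set u \<subseteq> {..<L}" "w = concat (replicate d u)"
        by (auto simp: words_def)
      have "rotate e w = w"
        using rotate_append[of u "concat (replicate d' u)"] u by (simp add: d concat_replicate_commute)
      then show "w \<in> {w \<in> words (d * e) L. rotate e w = w}"
        using u assms by (auto simp: words_def length_concat_replicate set_concat_replicate)
    qed
    show "take e ` {w \<in> words (d * e) L. rotate e w = w} \<subseteq> words e L"
      by (auto simp: words_def d dest: in_set_takeD)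
  qed
qed

text \<open>Division with remainder by the least positive period.\<close>

lemma rotate_fixed_iff_dvd:
  assumes "length w > 0"
  obtains e where "e > 0" "\<And>j. rotate j w = w \<longleftrightarrow> e dvd j"
proof -
  define e where "e = (LEAST j. j > 0 \<and> rotate j w = w)"
  have "length w > 0 \<and> rotate (length w) w = w" using assms by simp
  then have e: "e > 0" "rotate e w = w"
    unfolding e_def by (metis (mono_tags, lifting) LeastI)+
  have least: "e \<le> j" if "j > 0" "rotate j w = w" for j
    unfolding e_def by (rule Least_le) (use that in simp)
  have mult: "rotate (k * e) w = w" for k
    by (induction k) (simp_all add: rotate_rotate[symmetric] e)
  show ?thesis
  proof
    fix j
    show "rotate j w = w \<longleftrightarrow> e dvd j"
    proof
      assume j: "rotate j w = w"
      have "rotate (j mod e) w = rotate (j mod e) (rotate (j div e * e) w)" by (simp add: mult)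
      also have "\<dots> = w" using j by (simp add: rotate_rotate)
      finally have "\<not> j mod e > 0" using least[of "j mod e"] mod_less_divisor[OF e(1), of j] by linarith
      then show "e dvd j" by auto
    next
      assume "e dvd j"
      then show "rotate j w = w" using mult by (metis dvd_div_mult_self)
    qed
  qed (rule e(1))
qed

text \<open>If \<open>e\<close> is the least period and \<open>m = e * q\<close>, then
  \<open>rotate (m div d)\<close> fixes \<open>w\<close> exactly when \<open>d\<close> divides
  \<open>q\<close>, and primitivity means \<open>q = 1\<close>.\<close>

lemma sum_moebius_mu_rotate_fixed:
  assumes "length w = m" "m > 0"
  shows "(\<Sum>d | d dvd m \<and> rotate (m div d) w = w. moebius_mu d) = (if primitive w then 1 else 0)"
proof -
  obtain e where e: "e > 0" "\<And>j. rotate j w = w \<longleftrightarrow> e dvd j"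
    using rotate_fixed_iff_dvd assms by metis
  have em: "e dvd m" using e(2)[of m] assms by simp
  then obtain q where q: "m = e * q" by (rule dvdE)
  then have "q > 0" using assms by (cases q) auto
  note q = q this
  have "{d. d dvd m \<and> rotate (m div d) w = w} = {d. d dvd q}"
  proof (intro Collect_cong iffI)
    fix d assume d: "d dvd m \<and> rotate (m div d) w = w"
    then obtain r where r: "m div d = e * r" using e(2) by (auto elim!: dvdE)
    then have "m = d * (e * r)" using d by (metis dvd_mult_div_cancel)
    then have "q = d * r" using q e(1) by simp
    then show "d dvd q" by simp
  next
    fix d assume "d dvd q"
    then obtain r where "q = d * r" by (auto elim!: dvdE)
    then show "d dvd m \<and> rotate (m div d) w = w" using q e by auto
  qed
  moreover have "primitive w \<longleftrightarrow> q = 1"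
  proof
    assume "primitive w"
    then have "\<not> e < m" using e assms by (auto simp: primitive_def)
    then show "q = 1" using q e(1) assms by (cases q) auto
  next
    assume "q = 1"
    then show "primitive w" using q e assms by (auto simp: primitive_def dest: nat_dvd_not_less)
  qed
  ultimately show ?thesis using sum_moebius_mu[OF q(2)] by simp
qed

text \<open>Moebius inversion over the periods. With \<open>g\<close> reading off coefficients, the
  right-hand side becomes the sum of \<open>\<mu>(d) p_d ^ (m / d)\<close>, that is,
  \<open>m L_m\<close>.\<close>

lemma sum_primitive_words:
  fixes g :: "nat list \<Rightarrow> real"
  assumes "m > 0"
  shows "(\<Sum>w | w \<in> words m L \<and> primitive w. g w) =
    (\<Sum>d | d dvd m. of_int (moebius_mu d) * (\<Sum>u\<in>words (m div d) L. g (concat (replicate d u))))"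
proof -
  have "(\<Sum>d | d dvd m. of_int (moebius_mu d) * (\<Sum>u\<in>words (m div d) L. g (concat (replicate d u)))) =
      (\<Sum>d | d dvd m. \<Sum>w | w \<in> words m L \<and> rotate (m div d) w = w. of_int (moebius_mu d) * g w)"
  proof (intro sum.cong refl)
    fix d assume "d \<in> {d. d dvd m}"
    then have d: "d > 0" "d * (m div d) = m" using assms by (auto intro: Nat.gr0I)
    show "of_int (moebius_mu d) * (\<Sum>u\<in>words (m div d) L. g (concat (replicate d u))) =
        (\<Sum>w | w \<in> words m L \<and> rotate (m div d) w = w. of_int (moebius_mu d) * g w)"
      using sum.reindex_bij_betw[OF bij_betw_concat_replicate[OF d(1), of "m div d" L], of g]
      unfolding d(2) sum_distrib_left[symmetric] by simp
  qed
  also have "\<dots> = (\<Sum>d | d dvd m. \<Sum>w\<in>words m L. of_bool (rotate (m div d) w = w) * (of_int (moebius_mu d) * g w))"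
    by (intro sum.cong refl sum.mono_neutral_cong_left) auto
  also have "\<dots> = (\<Sum>w\<in>words m L. \<Sum>d | d dvd m. of_bool (rotate (m div d) w = w) * (of_int (moebius_mu d) * g w))"
    by (rule sum.swap)
  also have "\<dots> = (\<Sum>w\<in>words m L. of_int (\<Sum>d | d dvd m \<and> rotate (m div d) w = w. moebius_mu d) * g w)"
  proof (intro sum.cong refl)
    fix w
    show "(\<Sum>d | d dvd m. of_bool (rotate (m div d) w = w) * (of_int (moebius_mu d) * g w)) =
        of_int (\<Sum>d | d dvd m \<and> rotate (m div d) w = w. moebius_mu d) * g w"
      unfolding of_int_sum sum_distrib_right
      using assms by (intro sum.mono_neutral_cong_right) auto
  qed
  also have "\<dots> = (\<Sum>w\<in>words m L. (if primitive w then 1 else 0) * g w)"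
    by (intro sum.cong refl, subst sum_moebius_mu_rotate_fixed[OF _ assms]) (auto simp: words_def)
  also have "\<dots> = (\<Sum>w | w \<in> words m L \<and> primitive w. g w)"
    by (intro sum.mono_neutral_cong_right) auto
  finally show ?thesis by simp
qed

section \<open>Powers of power sums as sums over words\<close>

text \<open>Let \<open>x_u\<close> be the product of the variables indexed by the letters of
  \<open>u\<close>, all below \<open>length a\<close>. Then \<open>fits\<close> says that
  \<open>x_u ^ j\<close> divides the monomial with exponents \<open>a\<close>, and
  \<open>remove_letters\<close> is the quotient.\<close>

definition fits :: "nat \<Rightarrow> nat list \<Rightarrow> nat list \<Rightarrow> bool" where
  "fits j u a \<longleftrightarrow> (\<forall>k<length a. j * count_list u k \<le> a ! k)"

definition remove_letters :: "nat \<Rightarrow> nat list \<Rightarrow> nat list \<Rightarrow> nat list" where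
  "remove_letters j u a = map (\<lambda>k. a ! k - j * count_list u k) [0..<length a]"

lemma words_Suc: "words (Suc q) L = (\<lambda>(x, u). x # u) ` ({..<L} \<times> words q L)"
proof (intro equalityI subsetI)
  fix w assume "w \<in> words (Suc q) L"
  then show "w \<in> (\<lambda>(x, u). x # u) ` ({..<L} \<times> words q L)"
    by (cases w) (auto simp: words_def)
qed (auto simp: words_def)

text \<open>\<open>p_j ^ q\<close> expands into the sum of \<open>x_u ^ j\<close> over all words
  \<open>u\<close> of length \<open>q\<close>.\<close>

lemma psum_mult_funpow_words:
  "(psum_mult j ^^ q) f a =
     (\<Sum>u\<in>words q (length a). if fits j u a then f (remove_letters j u a) else 0)"
proof (induction q arbitrary: a)
  case 0
  have "words 0 (length a) = {[]}" by (auto simp: words_def)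
  moreover have "remove_letters j [] a = a" by (simp add: remove_letters_def map_nth)
  ultimately show ?case by (simp add: fits_def)
next
  case (Suc q)
  let ?L = "length a"
  let ?h = "\<lambda>u a. if fits j u a then f (remove_letters j u a) else 0"
  have step: "(if j \<le> a ! x then ?h u (a[x := a ! x - j]) else 0) = ?h (x # u) a" if x: "x < ?L" for x u
  proof -
    have "fits j (x # u) a \<longleftrightarrow> j \<le> a ! x \<and> fits j u (a[x := a ! x - j])"
      using x by (force simp: fits_def nth_list_update)
    moreover have "remove_letters j u (a[x := a ! x - j]) = remove_letters j (x # u) a"
      by (rule nth_equalityI) (auto simp: remove_letters_def nth_list_update)
    ultimately show ?thesis by simp
  qed
  have "(psum_mult j ^^ Suc q) f a = psum_mult j ((psum_mult j ^^ q) f) a" by simp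
  also have "\<dots> = (\<Sum>x<?L. if j \<le> a ! x then (\<Sum>u\<in>words q ?L. ?h u (a[x := a ! x - j])) else 0)"
    unfolding psum_mult_def[of j "(psum_mult j ^^ q) f"] by (simp add: Suc.IH cong: if_cong)
  also have "\<dots> = (\<Sum>x<?L. \<Sum>u\<in>words q ?L. ?h (x # u) a)"
    by (intro sum.cong refl) (auto simp: step[symmetric])
  also have "\<dots> = (\<Sum>(x, u)\<in>{..<?L} \<times> words q ?L. ?h (x # u) a)"
    by (rule sum.cartesian_product)
  also have "\<dots> = (\<Sum>u\<in>words (Suc q) ?L. ?h u a)"
    unfolding words_Suc by (subst sum.reindex) (auto simp: inj_on_def intro!: sum.cong)
  finally show ?case .
qed

lemma fits_concat_replicate: "fits k (concat (replicate d u)) a \<longleftrightarrow> fits (k * d) u a"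
  by (simp add: fits_def count_list_concat_replicate mult.assoc)

lemma remove_letters_concat_replicate:
  "remove_letters k (concat (replicate d u)) a = remove_letters (k * d) u a"
  by (simp add: remove_letters_def count_list_concat_replicate mult.assoc)

section \<open>Newton's recurrence for necklace counts\<close>

text \<open>For \<open>m > 0\<close> this is the coefficient in the product of
  \<open>1 / (1 - x_w)\<close> over primitive necklaces of length \<open>m\<close>, the sum of all
  \<open>h_r[L_m]\<close>; the degree \<open>sum_list a = m * r\<close> selects
  \<open>r\<close>.\<close>

definition necklace_count :: "nat \<Rightarrow> nat list \<Rightarrow> real" where
  "necklace_count m a = real (card (necklace_multisets m a))"

lemma necklace_multisetsD:
  assumes "N \<in> necklace_multisets m a"
  shows "N w \<noteq> 0 \<Longrightarrow> w \<in> words m (length a)" "N w \<noteq> 0 \<Longrightarrow> primitive w" "N (rotate1 w) = N w"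
    "k < length a \<Longrightarrow> (\<Sum>w | w \<in> words m (length a) \<and> hd w = k. N w) = a ! k"
  using assms by (auto simp: necklace_multisets_def)

lemma hd_words_less:
  assumes "w \<in> words m L" "m > 0"
  shows "hd w < L"
  using assms by (cases w) (auto simp: words_def)

lemma sum_necklace_multiset:
  assumes "N \<in> necklace_multisets m a" "m > 0"
  shows "(\<Sum>w\<in>words m (length a). N w) = sum_list a"
proof -
  have "(\<Sum>w\<in>words m (length a). N w) = (\<Sum>k<length a. \<Sum>w | w \<in> words m (length a) \<and> hd w = k. N w)"
    by (rule sum.group[symmetric]) (use hd_words_less[OF _ assms(2)] in auto)
  also have "\<dots> = (\<Sum>k<length a. a ! k)"
    using necklace_multisetsD(4)[OF assms(1)] by simp
  also have "\<dots> = sum_list a"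
    by (simp add: sum_list_sum_nth atLeast0LessThan)
  finally show ?thesis .
qed

lemma necklace_multiset_le:
  assumes "N \<in> necklace_multisets m a" "m > 0"
  shows "N w \<le> sum_list a"
proof (cases "N w = 0")
  case False
  then have "w \<in> words m (length a)" using necklace_multisetsD[OF assms(1)] by simp
  then have "N w \<le> (\<Sum>w\<in>words m (length a). N w)" by (intro member_le_sum) auto
  then show ?thesis using sum_necklace_multiset[OF assms] by simp
qed simp

lemma finite_necklace_multisets:
  assumes "m > 0"
  shows "finite (necklace_multisets m a)"
proof (rule finite_subset)
  show "necklace_multisets m a \<subseteq>
      {N. \<forall>w. (w \<in> words m (length a) \<longrightarrow> N w \<in> {..sum_list a}) \<and> (w \<notin> words m (length a) \<longrightarrow> N w = 0)}"
    using necklace_multiset_le[OF _ assms] necklace_multisetsD(1) by blast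
  show "finite {N. \<forall>w. (w \<in> words m (length a) \<longrightarrow> N w \<in> {..sum_list a}) \<and> (w \<notin> words m (length a) \<longrightarrow> N w = 0)}"
    by (rule finite_set_of_finite_funs) auto
qed

lemma necklace_count_sum_0:
  assumes "sum_list a = 0" "m > 0"
  shows "necklace_count m a = 1"
proof -
  have "necklace_multisets m a = {\<lambda>_. 0}"
  proof (intro equalityI subsetI)
    fix N assume "N \<in> necklace_multisets m a"
    then show "N \<in> {\<lambda>_. 0}" using necklace_multiset_le[OF _ assms(2), of N a] assms by auto
  next
    fix N :: "nat list \<Rightarrow> nat" assume "N \<in> {\<lambda>_. 0}"
    then show "N \<in> necklace_multisets m a"
      using assms(1) by (auto simp: necklace_multisets_def)
  qed
  then show ?thesis by (simp add: necklace_count_def)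
qed

definition rotations :: "nat list \<Rightarrow> nat list set" where
  "rotations w = range (\<lambda>j. rotate j w)"

lemma rotate1_in_rotations_iff: "rotate1 v \<in> rotations w \<longleftrightarrow> v \<in> rotations w"
proof
  assume "v \<in> rotations w"
  then show "rotate1 v \<in> rotations w"
    by (auto simp: rotations_def rotate_Suc[symmetric] simp del: rotate_Suc)
next
  assume "rotate1 v \<in> rotations w"
  then obtain j where "rotate1 v = rotate j w" by (auto simp: rotations_def)
  \<comment> \<open>The additional full turn makes the exponent positive for nonempty
    \<open>w\<close>, so that one \<open>rotate1\<close> can be cancelled.\<close>
  also have "\<dots> = rotate (j + length w) w" by (subst (1 2) rotate_conv_mod) simp
  finally have j: "rotate1 v = rotate (j + length w) w" .
  show "v \<in> rotations w"
  proof (cases "length w")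
    case 0
    then show ?thesis using j by (auto simp: rotations_def)
  next
    case (Suc l)
    then have "rotate1 v = rotate1 (rotate (j + l) w)" using j by simp
    then have "v = rotate (j + l) w" using injD[OF inj_rotate1] by blast
    then show ?thesis by (auto simp: rotations_def)
  qed
qed

lemma rotations_subset_words:
  assumes "w \<in> words m L"
  shows "rotations w \<subseteq> words m L"
  using assms by (auto simp: rotations_def words_def)

lemma primitive_rotations:
  assumes "primitive w" "v \<in> rotations w"
  shows "primitive v"
  unfolding primitive_def
proof (intro allI impI notI)
  obtain i where v: "v = rotate i w" using assms by (auto simp: rotations_def)
  fix j assume j: "0 < j \<and> j < length v" "rotate j v = v"
  have inj: "inj (rotate i)" unfolding rotate_def by (rule inj_fn[OF inj_rotate1])
  have "rotate i (rotate j w) = rotate i w"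
    using j(2) by (simp add: v rotate_rotate add.commute)
  then have "rotate j w = w" using injD[OF inj] by blast
  then show False using assms(1) j(1) by (auto simp: primitive_def v)
qed

text \<open>The \<open>m\<close> rotations of a primitive word are distinct, and
  \<open>rotate j w\<close> starts with the letter at position \<open>j\<close>.\<close>

lemma card_rotations_hd:
  assumes "primitive w" "w \<in> words m L" "m > 0"
  shows "card {v \<in> rotations w. hd v = x} = count_list w x"
proof -
  have len: "length w = m" using assms by (simp add: words_def)
  have rot: "rotations w = (\<lambda>j. rotate j w) ` {..<m}"
  proof (intro equalityI subsetI)
    fix v assume "v \<in> rotations w"
    then obtain j where "v = rotate j w" by (auto simp: rotations_def)
    then have "v = rotate (j mod m) w" using rotate_conv_mod[of j w] len by simp
    then show "v \<in> (\<lambda>j. rotate j w) ` {..<m}" using assms(3) by auto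
  qed (auto simp: rotations_def)
  have less: "rotate i w \<noteq> rotate j w" if "i < j" "j < m" for i j
  proof
    assume eq: "rotate i w = rotate j w"
    have "rotate i (rotate (j - i) w) = rotate i w" using that eq by (simp add: rotate_rotate)
    then have "rotate (j - i) w = w"
      by (rule injD[OF inj_fn[OF inj_rotate1], folded rotate_def])
    then show False using assms(1) that len by (auto simp: primitive_def)
  qed
  have inj: "inj_on (\<lambda>j. rotate j w) {..<m}"
  proof (rule inj_onI)
    fix i j assume "i \<in> {..<m}" "j \<in> {..<m}" "rotate i w = rotate j w"
    then show "i = j" using less[of i j] less[of j i] by (cases i j rule: linorder_cases) auto
  qed
  have "{v \<in> rotations w. hd v = x} = (\<lambda>j. rotate j w) ` {j. j < m \<and> w ! j = x}"
  proof -
    have "hd (rotate j w) = w ! j" if "j < m" for j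
      using that len assms(3) by (subst hd_rotate_conv_nth) auto
    then show ?thesis unfolding rot by auto
  qed
  also have "card \<dots> = card {j. j < m \<and> w ! j = x}"
    by (rule card_image) (rule inj_on_subset[OF inj], auto)
  also have "\<dots> = count_list w x"
    unfolding count_list_eq_length_filter length_filter_conv_card len by (simp add: eq_commute)
  finally show ?thesis .
qed

lemma sum_indicator_rotations:
  assumes "primitive w" "w \<in> words m L" "m > 0"
  shows "(\<Sum>v | v \<in> words m L \<and> hd v = x. if v \<in> rotations w then k else 0) = k * count_list w x"
proof -
  have "(\<Sum>v | v \<in> words m L \<and> hd v = x. if v \<in> rotations w then k else 0) =
      (\<Sum>v | v \<in> rotations w \<and> hd v = x. k)"
    using rotations_subset_words[OF assms(2)] by (intro sum.mono_neutral_cong_right) auto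
  then show ?thesis using card_rotations_hd[OF assms, of x] by (simp add: mult.commute)
qed

text \<open>Taking \<open>k\<close> copies of a necklace out of a multiset lowers \<open>N\<close>
  by \<open>k\<close> on all rotations of \<open>w\<close> and uses up every letter of
  \<open>w\<close> exactly \<open>k\<close> times.\<close>

lemma card_necklace_multisets_ge:
  assumes w: "primitive w" "w \<in> words m (length a)" and "m > 0"
  shows "card {N \<in> necklace_multisets m a. k \<le> N w} =
    (if fits k w a then card (necklace_multisets m (remove_letters k w a)) else 0)"
proof -
  let ?L = "length a"
  let ?I = "\<lambda>v. if v \<in> rotations w then k else 0"
  let ?Y = "{N \<in> necklace_multisets m a. k \<le> N w}"
  have I_le: "?I v \<le> N v" if N: "N \<in> ?Y" for N v
  proof (cases "v \<in> rotations w")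
    case True
    then obtain j where v: "v = rotate j w" by (auto simp: rotations_def)
    have "N (rotate j w) = N w"
      using necklace_multisetsD(3)[of N m a] N by (induction j) auto
    then show ?thesis using N v by simp
  qed simp
  have fits: "fits k w a" if N: "N \<in> ?Y" for N
    unfolding fits_def
  proof (intro allI impI)
    fix x assume x: "x < ?L"
    have "k * count_list w x = (\<Sum>v | v \<in> words m ?L \<and> hd v = x. ?I v)"
      by (rule sum_indicator_rotations[OF assms(1-3), symmetric])
    also have "\<dots> \<le> (\<Sum>v | v \<in> words m ?L \<and> hd v = x. N v)"
      by (intro sum_mono I_le[OF N])
    also have "\<dots> = a ! x" using N x necklace_multisetsD(4) by blast
    finally show "k * count_list w x \<le> a ! x" .
  qed
  show ?thesis
  proof (cases "fits k w a")
    case False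
    then have "?Y = {}" using fits by blast
    then show ?thesis using False by (simp only: card.empty if_False)
  next
    case True
    let ?b = "remove_letters k w a"
    have len: "length ?b = ?L" by (simp add: remove_letters_def)
    have b: "?b ! x = a ! x - k * count_list w x" "k * count_list w x \<le> a ! x" if "x < ?L" for x
      using that True by (auto simp: remove_letters_def fits_def)
    have "bij_betw (\<lambda>N v. N v - ?I v) ?Y (necklace_multisets m ?b)"
    proof (rule bij_betw_byWitness[where f' = "\<lambda>N v. N v + ?I v"])
      show "\<forall>N\<in>?Y. (\<lambda>v. N v - ?I v + ?I v) = N"
        using I_le by (auto intro!: ext)
      show "\<forall>N\<in>necklace_multisets m ?b. (\<lambda>v. N v + ?I v - ?I v) = N"
        by auto
      show "(\<lambda>N v. N v - ?I v) ` ?Y \<subseteq> necklace_multisets m ?b"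
      proof
        fix M assume "M \<in> (\<lambda>N v. N v - ?I v) ` ?Y"
        then obtain N where N: "N \<in> ?Y" and M: "M = (\<lambda>v. N v - ?I v)" by blast
        then have N': "N \<in> necklace_multisets m a" by simp
        have "(\<Sum>v | v \<in> words m ?L \<and> hd v = x. M v) = ?b ! x" if x: "x < ?L" for x
        proof -
          have "(\<Sum>v | v \<in> words m ?L \<and> hd v = x. M v) =
              (\<Sum>v | v \<in> words m ?L \<and> hd v = x. N v) - (\<Sum>v | v \<in> words m ?L \<and> hd v = x. ?I v)"
            unfolding M by (rule sum_subtractf_nat) (rule I_le[OF N])
          then show ?thesis
            using sum_indicator_rotations[OF assms(1-3)] necklace_multisetsD(4)[OF N' x] b(1)[OF x] by simp
        qed
        moreover have "M v \<noteq> 0 \<Longrightarrow> v \<in> words m ?L \<and> primitive v" for v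
          using necklace_multisetsD(1,2)[OF N', of v] by (auto simp: M split: if_splits)
        moreover have "M (rotate1 v) = M v" for v
          using necklace_multisetsD(3)[OF N', of v] by (simp add: M rotate1_in_rotations_iff)
        ultimately show "M \<in> necklace_multisets m ?b"
          by (simp add: necklace_multisets_def len)
      qed
      show "(\<lambda>N v. N v + ?I v) ` necklace_multisets m ?b \<subseteq> ?Y"
      proof
        fix M assume "M \<in> (\<lambda>N v. N v + ?I v) ` necklace_multisets m ?b"
        then obtain N where N: "N \<in> necklace_multisets m ?b" and M: "M = (\<lambda>v. N v + ?I v)" by blast
        have "(\<Sum>v | v \<in> words m ?L \<and> hd v = x. M v) = a ! x" if x: "x < ?L" for x
        proof -
          have "(\<Sum>v | v \<in> words m ?L \<and> hd v = x. M v) =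
              (\<Sum>v | v \<in> words m ?L \<and> hd v = x. N v) + (\<Sum>v | v \<in> words m ?L \<and> hd v = x. ?I v)"
            unfolding M by (rule sum.distrib)
          also have "\<dots> = ?b ! x + k * count_list w x"
            using sum_indicator_rotations[OF assms(1-3)] necklace_multisetsD(4)[OF N, of x] x len by simp
          finally show ?thesis using b[OF x] by simp
        qed
        moreover have "v \<in> words m ?L \<and> primitive v" if "M v \<noteq> 0" for v
        proof (cases "v \<in> rotations w")
          case True
          then show ?thesis using rotations_subset_words[OF w(2)] primitive_rotations[OF w(1)] by blast
        next
          case False
          then show ?thesis using necklace_multisetsD(1,2)[OF N, of v] that len by (simp add: M)
        qed
        moreover have "M (rotate1 v) = M v" for v
          using necklace_multisetsD(3)[OF N, of v] by (simp add: M rotate1_in_rotations_iff)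
        moreover have "w \<in> rotations w" by (auto simp: rotations_def intro: range_eqI[of _ _ 0])
        ultimately show "M \<in> ?Y"
          by (simp add: necklace_multisets_def M)
      qed
    qed
    then show ?thesis using True by (simp add: bij_betw_same_card)
  qed
qed

text \<open>Triples \<open>(N, w, k)\<close> with \<open>1 \<le> k \<le> N w\<close> are counted
  twice. Each \<open>N\<close> has total multiplicity \<open>sum_list a\<close>; for fixed
  \<open>w\<close> and \<open>k\<close>, removing \<open>k\<close> copies of the necklace leaves an
  arbitrary multiset of the remaining content. Summing over words instead of necklaces accounts for
  the factor \<open>m\<close> in \<open>sum_list a = m * r\<close>.\<close>

lemma necklace_count_rec:
  assumes "m > 0"
  shows "real (sum_list a) * necklace_count m a =
    (\<Sum>k=1..sum_list a. \<Sum>d | d dvd m. of_int (moebius_mu d) * (psum_mult (k * d) ^^ (m div d)) (necklace_count m) a)"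
proof -
  let ?Y = "necklace_multisets m a" and ?L = "length a" and ?s = "sum_list a"
  let ?W = "{w. w \<in> words m ?L \<and> primitive w}"
  have fin: "finite ?W" "finite ?Y" using finite_necklace_multisets[OF assms] by auto
  have "?s * card ?Y = (\<Sum>N\<in>?Y. \<Sum>w\<in>?W. N w)"
  proof -
    have "(\<Sum>w\<in>?W. N w) = ?s" if "N \<in> ?Y" for N
    proof -
      have "(\<Sum>w\<in>?W. N w) = (\<Sum>w\<in>words m ?L. N w)"
        using necklace_multisetsD(2)[OF that] by (intro sum.mono_neutral_left) auto
      then show ?thesis using sum_necklace_multiset[OF that assms] by simp
    qed
    then show ?thesis by simp
  qed
  also have "\<dots> = (\<Sum>w\<in>?W. \<Sum>N\<in>?Y. N w)"
    by (rule sum.swap)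
  also have "\<dots> = (\<Sum>w\<in>?W. \<Sum>N\<in>?Y. \<Sum>k=1..?s. of_bool (k \<le> N w))"
  proof (intro sum.cong refl)
    fix w N assume "N \<in> ?Y"
    then have "N w \<le> ?s" by (rule necklace_multiset_le[OF _ assms])
    then have "{1..?s} \<inter> {k. k \<le> N w} = {1..N w}" by auto
    then show "N w = (\<Sum>k=1..?s. of_bool (k \<le> N w))" by simp
  qed
  also have "\<dots> = (\<Sum>w\<in>?W. \<Sum>k=1..?s. \<Sum>N\<in>?Y. of_bool (k \<le> N w))"
    by (intro sum.cong refl sum.swap)
  also have "\<dots> = (\<Sum>w\<in>?W. \<Sum>k=1..?s. card {N \<in> ?Y. k \<le> N w})"
    using fin by (simp add: Int_def)
  also have "\<dots> = (\<Sum>k=1..?s. \<Sum>w\<in>?W. card {N \<in> ?Y. k \<le> N w})"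
    by (rule sum.swap)
  finally have "real ?s * necklace_count m a = (\<Sum>k=1..?s. \<Sum>w\<in>?W. real (card {N \<in> ?Y. k \<le> N w}))"
    unfolding necklace_count_def of_nat_mult[symmetric] by simp
  also have "\<dots> = (\<Sum>k=1..?s. \<Sum>w\<in>?W. if fits k w a then necklace_count m (remove_letters k w a) else 0)"
    using assms by (intro sum.cong refl, subst card_necklace_multisets_ge) (auto simp: necklace_count_def)
  also have "\<dots> = (\<Sum>k=1..?s. \<Sum>d | d dvd m. of_int (moebius_mu d) *
      (psum_mult (k * d) ^^ (m div d)) (necklace_count m) a)"
    by (subst sum_primitive_words[OF assms])
      (simp add: fits_concat_replicate remove_letters_concat_replicate psum_mult_funpow_words cong: if_cong)
  finally show ?thesis .
qed

text \<open>Instead of relabelling letters, the recurrence expresses both counts by counts of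
  smaller degree: its terms lower the degree by \<open>k * m > 0\<close>.\<close>

lemma zero_insertion_invariant_necklace_count:
  assumes "m > 0"
  shows "zero_insertion_invariant n (necklace_count m)"
proof (induction n rule: less_induct)
  case (less n)
  show ?case
    unfolding zero_insertion_invariant_def
  proof (intro allI impI)
    fix xs ys :: "nat list" assume s: "sum_list xs + sum_list ys = n"
    show "necklace_count m (xs @ 0 # ys) = necklace_count m (xs @ ys)"
    proof (cases "n = 0")
      case True
      then show ?thesis using s assms by (simp add: necklace_count_sum_0)
    next
      case False
      have eq: "(psum_mult j ^^ q) (necklace_count m) (xs @ 0 # ys) = (psum_mult j ^^ q) (necklace_count m) (xs @ ys)"
        if "j > 0" "q > 0" for j q
      proof (cases "q * j \<le> n")
        case True
        then have "zero_insertion_invariant (q * j + (n - q * j)) ((psum_mult j ^^ q) (necklace_count m))"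
          using that False by (intro zero_insertion_invariant_psum_mult_funpow less.IH) auto
        then show ?thesis using True s by (simp add: zero_insertion_invariant_def)
      next
        case False
        then show ?thesis using s by (simp add: psum_mult_funpow_eq_0)
      qed
      have "real n * necklace_count m (xs @ 0 # ys) = real n * necklace_count m (xs @ ys)"
      proof -
        have "(\<Sum>k=1..n. \<Sum>d | d dvd m. of_int (moebius_mu d) *
              (psum_mult (k * d) ^^ (m div d)) (necklace_count m) (xs @ 0 # ys)) =
            (\<Sum>k=1..n. \<Sum>d | d dvd m. of_int (moebius_mu d) *
              (psum_mult (k * d) ^^ (m div d)) (necklace_count m) (xs @ ys))"
        proof (intro sum.cong refl arg_cong2[where f = times] eq)
          fix k d assume "k \<in> {1..n}" "d \<in> {d. d dvd m}"
          then show "k * d > 0" "m div d > 0"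
            using assms by (auto intro: Nat.gr0I simp: dvd_div_eq_0_iff)
        qed
        then show ?thesis
          using necklace_count_rec[OF assms, of "xs @ 0 # ys"] necklace_count_rec[OF assms, of "xs @ ys"] s
          by simp
      qed
      then show ?thesis using False by simp
    qed
  qed
qed

subsection \<open>Euler numbers\<close>

context
  notes add_2_eq_Suc [simp del] add_2_eq_Suc' [simp del] One_nat_def [simp del]
begin

text \<open>The series 1, so that \<open>(psum_mult 1 ^^ n) const_coeff\<close> is
  \<open>p_1 ^ n\<close>, whose coefficients are multinomial.\<close>

definition const_coeff :: "nat list \<Rightarrow> real" where
  "const_coeff a = of_bool (sum_list a = 0)"

text \<open>A multinomial coefficient splits off its first entry as a binomial coefficient; the
  induction step is Pascal's rule.\<close>

lemma psum_mult_1_funpow_Cons: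
  "(psum_mult 1 ^^ n) const_coeff (x # a) =
     (if x \<le> n then of_nat (n choose x) * (psum_mult 1 ^^ (n - x)) const_coeff a else 0)"
proof (induction n arbitrary: x a)
  case 0
  then show ?case by (auto simp: const_coeff_def)
next
  case (Suc n)
  let ?M = "\<lambda>n. (psum_mult 1 ^^ n) const_coeff"
  have eq: "?M (Suc n) (x # a) = (if 1 \<le> x then ?M n ((x - 1) # a) else 0) + psum_mult 1 (\<lambda>b. ?M n (x # b)) a"
    by (simp add: psum_mult_Cons)
  have "psum_mult 1 (\<lambda>b. ?M n (x # b)) a = (if x \<le> n then of_nat (n choose x) * ?M (Suc n - x) a else 0)"
  proof (cases "x \<le> n")
    case True
    then show ?thesis
      by (simp add: Suc.IH psum_mult_cmult Suc_diff_le)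
  next
    case False
    then show ?thesis
      by (simp add: Suc.IH psum_mult_def)
  qed
  moreover have "(if 1 \<le> x then ?M n ((x - 1) # a) else 0) =
      (if 1 \<le> x \<and> x \<le> Suc n then of_nat (n choose (x - 1)) * ?M (Suc n - x) a else 0)"
    by (cases x) (auto simp: Suc.IH)
  ultimately show ?case
    unfolding eq by (cases x) (auto simp: algebra_simps not_le le_Suc_eq)
qed

text \<open>After a first part of parity \<open>e\<close>, the later interior sums must exceed it by
  even amounts, so the tail has type \<open>False\<close> for either \<open>e\<close>.\<close>

lemma compositions_Cons:
  assumes "n > 0"
  shows "compositions e n = insert [n]
    ((\<lambda>(x, b). x # b) ` Sigma (parity_positions e n) (\<lambda>x. compositions False (n - x)))"
proof (intro equalityI subsetI)
  fix a assume a: "a \<in> compositions e n"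
  show "a \<in> insert [n] ((\<lambda>(x, b). x # b) ` Sigma (parity_positions e n) (\<lambda>x. compositions False (n - x)))"
  proof (cases a)
    case Nil
    then show ?thesis using a assms by (simp add: compositions_def)
  next
    case (Cons x b)
    show ?thesis
    proof (cases "b = []")
      case True
      then show ?thesis using a Cons by (simp add: compositions_def)
    next
      case False
      have prefix: "odd (sum_list (take i a)) \<longleftrightarrow> e" if "0 < i" "i < length a" for i
        using a that by (simp add: compositions_def)
      have x: "odd x \<longleftrightarrow> e"
        using prefix[of 1] False Cons by (simp add: One_nat_def)
      have "even (sum_list (take i b))" if "0 < i" "i < length b" for i
        using prefix[of "Suc i"] that x Cons by auto
      moreover have "sum_list b > 0" "0 \<notin> set b" "x > 0" "x + sum_list b = n"
        using False a Cons by (auto simp: compositions_def neq_Nil_conv)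
      ultimately have "x \<in> parity_positions e n" "b \<in> compositions False (n - x)"
        using x by (auto simp: parity_positions_def compositions_def)
      then show ?thesis using Cons by force
    qed
  qed
next
  fix a assume "a \<in> insert [n] ((\<lambda>(x, b). x # b) ` Sigma (parity_positions e n) (\<lambda>x. compositions False (n - x)))"
  then consider "a = [n]" | x b where "a = x # b" "x \<in> parity_positions e n" "b \<in> compositions False (n - x)"
    by auto
  then show "a \<in> compositions e n"
  proof cases
    case 1
    then show ?thesis using assms by (auto simp: compositions_def)
  next
    case 2
    have "odd (sum_list (take i a)) \<longleftrightarrow> e" if "0 < i" "i < length a" for i
      using 2 that by (cases i; cases "i = 1") (auto simp: compositions_def parity_positions_def One_nat_def)
    then show ?thesis using 2 by (auto simp: compositions_def parity_positions_def)
  qed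
qed

lemma ribbon_Cons:
  assumes "n > 0"
  shows "ribbon e n f = (-1) ^ card (parity_positions e n) * f [n] +
    (\<Sum>x\<in>parity_positions e n. (-1) ^ (card (parity_positions e n) + card (parity_positions False (n - x)) + 1) *
       ribbon False (n - x) (\<lambda>b. f (x # b)))"
proof -
  let ?c = "\<lambda>e n. card (parity_positions e n)"
  let ?S = "Sigma (parity_positions e n) (\<lambda>x. compositions False (n - x))"
  let ?h = "\<lambda>a. (-1) ^ (?c e n + length a + 1) * f a"
  have "[n] \<notin> (\<lambda>(x, b). x # b) ` ?S"
    by (auto simp: parity_positions_def)
  then have "ribbon e n f = ?h [n] + sum ?h ((\<lambda>(x, b). x # b) ` ?S)"
    unfolding ribbon_def compositions_Cons[OF assms] by (subst sum.insert) auto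
  also have "sum ?h ((\<lambda>(x, b). x # b) ` ?S) = (\<Sum>(x, b)\<in>?S. ?h (x # b))"
    by (subst sum.reindex) (auto simp: inj_on_def case_prod_beta)
  also have "\<dots> = (\<Sum>x\<in>parity_positions e n. \<Sum>b\<in>compositions False (n - x). ?h (x # b))"
    by (subst sum.Sigma) auto
  also have "\<dots> = (\<Sum>x\<in>parity_positions e n. (-1) ^ (?c e n + ?c False (n - x) + 1) *
       ribbon False (n - x) (\<lambda>b. f (x # b)))"
    unfolding ribbon_def sum_distrib_left
  proof (intro sum.cong refl, goal_cases)
    case (1 x b)
    have "(-1) ^ ?c False (n - x) * (-1) ^ ?c False (n - x) = (1 :: real)"
      by (simp add: power_mult_distrib[symmetric])
    then show ?case by (simp add: power_add)
  qed
  finally show ?thesis by (simp add: One_nat_def)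
qed

text \<open>The binomial factor makes this a convolution as for exponential generating functions:
  with the cosine for \<open>e = False\<close>, with the sine for \<open>e = True\<close>. Only type
  \<open>False\<close> occurs on the right, so that type is settled first.\<close>

lemma ribbon_psum_mult_1_Cons:
  assumes "n > 0"
  defines "G \<equiv> \<lambda>e n. ribbon e n ((psum_mult 1 ^^ n) const_coeff)"
  shows "G e n = (-1) ^ card (parity_positions e n) -
    (\<Sum>x\<in>parity_positions e n. (-1) ^ (card (parity_positions e n) + card (parity_positions False (n - x))) *
       (of_nat (n choose x) * G False (n - x)))"
proof -
  let ?M = "\<lambda>n. (psum_mult 1 ^^ n) const_coeff"
  have n: "?M n [n] = 1"
    by (subst psum_mult_1_funpow_Cons) (simp add: const_coeff_def)
  have Cons: "ribbon False (n - x) (\<lambda>b. ?M n (x # b)) = of_nat (n choose x) * G False (n - x)"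
    if "x \<in> parity_positions e n" for x
    using that unfolding G_def ribbon_cmult[symmetric] psum_mult_1_funpow_Cons
    by (simp add: parity_positions_def)
  show ?thesis
    unfolding G_def
    by (subst ribbon_Cons[OF assms(1)]) (simp add: n Cons[unfolded G_def] sum_negf[symmetric] power_add cong: sum.cong)
qed

section \<open>Recurrences of the Euler numbers\<close>

lemma fact_mult_fps_mult_nth:
  fixes f g :: "real fps"
  shows "fact n * fps_nth (f * g) n =
    (\<Sum>x\<le>n. of_nat (n choose x) * (fact x * fps_nth f x) * (fact (n - x) * fps_nth g (n - x)))"
  unfolding fps_mult_nth sum_distrib_left atLeast0AtMost
  by (intro sum.cong refl) (simp add: binomial_fact field_simps)

text \<open>Coefficients of \<open>cos x (sec x + tan x) = 1 + sin x\<close>.\<close>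

lemma euler_number_cos_rec:
  "(\<Sum>x\<le>n. if even x then of_nat (n choose x) * (-1) ^ (x div 2) * euler_number (n - x) else 0) =
     (if n = 0 then 1 else if odd n then (-1) ^ ((n - 1) div 2) else 0)"
proof -
  let ?U = "inverse (fps_cos 1) + fps_tan 1 :: real fps"
  have eq: "fps_cos 1 * ?U = 1 + fps_sin 1"
    by (simp add: fps_tan_def fps_divide_unit ring_distribs inverse_mult_eq_1' mult_ac)
  have "(\<Sum>x\<le>n. if even x then of_nat (n choose x) * (-1) ^ (x div 2) * euler_number (n - x) else 0) =
      fact n * fps_nth (fps_cos 1 * ?U) n"
    unfolding fact_mult_fps_mult_nth by (intro sum.cong refl) (simp add: euler_number_def fps_cos_def)
  also have "\<dots> = (if n = 0 then 1 else if odd n then (-1) ^ ((n - 1) div 2) else 0)"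
    unfolding eq by (simp add: fps_sin_def)
  finally show ?thesis .
qed

text \<open>Coefficients of \<open>sec x + tan x = cos x + sin x (sec x + tan x)\<close>, a
  consequence of \<open>cos^2 x + sin^2 x = 1\<close>.\<close>

lemma euler_number_sin_rec:
  "euler_number n = (if even n then (-1) ^ (n div 2) else 0) +
     (\<Sum>x\<le>n. if odd x then of_nat (n choose x) * (-1) ^ ((x - 1) div 2) * euler_number (n - x) else 0)"
proof -
  let ?C = "inverse (fps_cos 1) :: real fps"
  let ?U = "?C + fps_tan 1 :: real fps"
  have "?C = (fps_cos 1 ^ 2 + fps_sin 1 ^ 2) * ?C"
    using fps_sin_cos_sum_of_squares[of "1 :: real"] by simp
  also have "\<dots> = fps_cos 1 * (fps_cos 1 * ?C) + fps_sin 1 * (fps_sin 1 * ?C)"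
    by (simp add: algebra_simps power2_eq_square)
  also have "fps_cos 1 * ?C = 1"
    by (simp add: inverse_mult_eq_1')
  finally have eq: "?U = fps_cos 1 + fps_sin 1 * ?U"
    by (simp add: fps_tan_def fps_divide_unit algebra_simps)
  have "euler_number n = fact n * fps_nth (fps_cos 1 + fps_sin 1 * ?U) n"
    by (simp only: euler_number_def eq[symmetric])
  also have "\<dots> = fact n * fps_nth (fps_cos 1) n + fact n * fps_nth (fps_sin 1 * ?U) n"
    by (simp add: distrib_left)
  also have "fact n * fps_nth (fps_sin 1 * ?U) n =
      (\<Sum>x\<le>n. if odd x then of_nat (n choose x) * (-1) ^ ((x - 1) div 2) * euler_number (n - x) else 0)"
    unfolding fact_mult_fps_mult_nth by (intro sum.cong refl) (simp add: euler_number_def fps_sin_def)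
  finally show ?thesis by (simp add: fps_cos_def)
qed

lemma euler_number_0 [simp]: "euler_number 0 = 1"
  by (simp add: euler_number_def fps_tan_def fps_divide_unit)

lemma sum_atMost_parity:
  fixes g :: "nat \<Rightarrow> real"
  assumes "n > 0"
  shows "(\<Sum>x\<le>n. if odd x \<longleftrightarrow> e then g x else 0) =
    (if e then 0 else g 0) + (\<Sum>x\<in>parity_positions e n. g x) + (if odd n \<longleftrightarrow> e then g n else 0)"
proof -
  have "(\<Sum>x\<le>n. if odd x \<longleftrightarrow> e then g x else 0) = sum g {x. x \<le> n \<and> (odd x \<longleftrightarrow> e)}"
    by (simp add: sum.If_cases Int_def)
  also have "{x. x \<le> n \<and> (odd x \<longleftrightarrow> e)} =
      (if e then {} else {0}) \<union> (parity_positions e n \<union> (if odd n \<longleftrightarrow> e then {n} else {}))"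
    using assms by (auto simp: parity_positions_def One_nat_def Suc_le_eq odd_pos elim: order_le_neq_trans)
  also have "sum g \<dots> = sum g (if e then {} else {0}) + (sum g (parity_positions e n) +
      sum g (if odd n \<longleftrightarrow> e then {n} else {}))"
    using assms by (subst sum.union_disjoint, (auto simp: parity_positions_def)[3],
        subst sum.union_disjoint, auto simp: parity_positions_def)
  finally show ?thesis by simp
qed

lemma minus_one_power_even_pred:
  "n > 0 \<Longrightarrow> even n \<Longrightarrow> (-1) ^ ((n - 1) div 2) = (- ((-1) ^ (n div 2)) :: real)"
proof -
  assume "n > 0" "even n"
  then obtain k where "n = 2 * Suc k" by (metis evenE gr0_implies_Suc nat_0_less_mult_iff)
  then show ?thesis by (simp add: One_nat_def)
qed

text \<open>In the cosine recurrence the term \<open>x = 0\<close> is the number sought and the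
  interior even \<open>x\<close> match the sum over first parts. For even \<open>n\<close> the last
  term \<open>x = n\<close> supplies the sign of the one-part composition, for odd \<open>n\<close>
  the right-hand side does.\<close>

lemma ribbon_False_psum_mult_1:
  assumes "n > 0"
  shows "ribbon False n ((psum_mult 1 ^^ n) const_coeff) = euler_number n"
  using assms
proof (induction n rule: less_induct)
  case (less n)
  let ?T = "parity_positions False n"
  have IH: "ribbon False (n - x) ((psum_mult 1 ^^ (n - x)) const_coeff) = euler_number (n - x)"
    if "x \<in> ?T" for x
    using that by (intro less.IH) (auto simp: parity_positions_def)
  have sgn: "(-1) ^ (card ?T + card (parity_positions False (n - x))) = ((-1) ^ (x div 2) :: real)"
    if "x \<in> ?T" for x
  proof -
    have "card ?T = card (parity_positions False (n - x)) + x div 2"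
      using that unfolding card_parity_positions_False by (auto simp: parity_positions_def elim!: evenE)
    then show ?thesis by (simp add: power_add power_mult_distrib[symmetric])
  qed
  have "ribbon False n ((psum_mult 1 ^^ n) const_coeff) =
      (-1) ^ card ?T - (\<Sum>x\<in>?T. of_nat (n choose x) * (-1) ^ (x div 2) * euler_number (n - x))"
    by (subst ribbon_psum_mult_1_Cons[OF less.prems]) (simp add: IH sgn mult_ac cong: sum.cong)
  moreover have "(\<Sum>x\<le>n. if odd x \<longleftrightarrow> False then of_nat (n choose x) * (-1) ^ (x div 2) * euler_number (n - x) else 0) =
      (if odd n then (-1) ^ ((n - 1) div 2) else 0)"
    using euler_number_cos_rec[of n] less.prems by simp
  ultimately show ?case
    unfolding sum_atMost_parity[OF less.prems]
    using minus_one_power_even_pred[OF less.prems] less.prems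
    by (cases "even n") (simp_all add: card_parity_positions_False)
qed

lemma ribbon_psum_mult_1:
  assumes "n > 0"
  shows "ribbon e n ((psum_mult 1 ^^ n) const_coeff) = euler_number n"
proof (cases e)
  case True
  let ?T = "parity_positions True n"
  have IH: "ribbon False (n - x) ((psum_mult 1 ^^ (n - x)) const_coeff) = euler_number (n - x)"
    if "x \<in> ?T" for x
    using that by (intro ribbon_False_psum_mult_1) (auto simp: parity_positions_def)
  have sgn: "(-1) ^ (card ?T + card (parity_positions False (n - x))) = (- ((-1) ^ ((x - 1) div 2)) :: real)"
    if "x \<in> ?T" for x
  proof -
    from that have "odd x" "x < n" by (auto simp: parity_positions_def)
    then obtain y where y: "x = 2 * y + 1" "x < n" by (auto elim: oddE)
    then have "card ?T = Suc (card (parity_positions False (n - x)) + y)"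
      by (simp add: card_parity_positions_False card_parity_positions_True)
    then show ?thesis using y by (simp add: power_add power_mult_distrib[symmetric])
  qed
  have "ribbon True n ((psum_mult 1 ^^ n) const_coeff) =
      (-1) ^ card ?T + (\<Sum>x\<in>?T. of_nat (n choose x) * (-1) ^ ((x - 1) div 2) * euler_number (n - x))"
    by (subst ribbon_psum_mult_1_Cons[OF assms]) (simp add: IH sgn mult_ac sum_negf cong: sum.cong)
  moreover have "euler_number n = (if even n then (-1) ^ (n div 2) else 0) +
      (\<Sum>x\<le>n. if odd x \<longleftrightarrow> True then of_nat (n choose x) * (-1) ^ ((x - 1) div 2) * euler_number (n - x) else 0)"
    by (subst euler_number_sin_rec) simp
  ultimately show ?thesis
    unfolding sum_atMost_parity[OF assms] using True
    by (auto simp: card_parity_positions_True elim!: oddE)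
qed (use ribbon_False_psum_mult_1[OF assms] in simp)

end

subsection \<open>Descent sets and compositions\<close>

lemma card_orbit_eq_iff:
  assumes "permutation p" "m > 0"
  shows "card (orbit p i) = m \<longleftrightarrow> (p ^^ m) i = i \<and> (\<forall>j. 0 < j \<and> j < m \<longrightarrow> (p ^^ j) i \<noteq> i)"
proof -
  have i: "i \<in> orbit p i" by (rule permutation_self_in_orbit[OF assms(1)])
  define D where "D = funpow_dist1 p i i"
  have D: "(p ^^ D) i = i" "D > 0"
    unfolding D_def using funpow_dist1_prop[OF i] by auto
  have least: "(p ^^ j) i \<noteq> i" if "0 < j" "j < D" for j
    using funpow_dist1_least[of j p i i] that by (simp add: D_def)
  have "card (orbit p i) = D"
    unfolding orbit_conv_funpow_dist1[OF i] D_def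
    by (subst card_image[OF inj_on_funpow_dist1[OF i]]) simp
  then show ?thesis
    using D least assms(2) by (metis linorder_neqE_nat)
qed

lemma uniform_perms_eq_cycles:
  assumes "m > 0"
  shows "uniform_perms m n = {p. p permutes {1..n} \<and> (\<forall>C\<in>perm_cycles n p. card C = m)}"
proof -
  have "card (orbit p i) = m \<longleftrightarrow> (p ^^ m) i = i \<and> (\<forall>j. 0 < j \<and> j < m \<longrightarrow> (p ^^ j) i \<noteq> i)"
    if "p permutes {1..n}" for p i
    using that by (intro card_orbit_eq_iff[OF _ assms]) (auto simp: permutation_permutes)
  then show ?thesis
    unfolding uniform_perms_def perm_cycles_def by blast
qed

definition descents :: "nat \<Rightarrow> (nat \<Rightarrow> nat) \<Rightarrow> nat set" where
  "descents n p = {i. 1 \<le> i \<and> i < n \<and> p i > p (i + 1)}"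

lemma alternating_iff_descents:
  assumes "p permutes {1..n}"
  shows "alternating n p \<longleftrightarrow> descents n p = parity_positions True n"
    and "reverse_alternating n p \<longleftrightarrow> descents n p = parity_positions False n"
proof -
  have "p i \<noteq> p (i + 1)" for i
    using injD[OF permutes_inj[OF assms], of i "i + 1"] by auto
  then have less_iff: "p i < p (i + 1) \<longleftrightarrow> \<not> p i > p (i + 1)" for i
    by (meson linorder_neqE_nat less_asym)
  have "alternating n p \<longleftrightarrow> (\<forall>i. 1 \<le> i \<and> i < n \<longrightarrow> (p i > p (i + 1) \<longleftrightarrow> odd i))"
    unfolding alternating_def less_iff by (intro iff_allI) (auto split: if_split)
  then show "alternating n p \<longleftrightarrow> descents n p = parity_positions True n"
    unfolding descents_def parity_positions_def set_eq_iff mem_Collect_eq by blast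
  have "reverse_alternating n p \<longleftrightarrow> (\<forall>i. 1 \<le> i \<and> i < n \<longrightarrow> (p i > p (i + 1) \<longleftrightarrow> even i))"
    unfolding reverse_alternating_def less_iff by (intro iff_allI) (auto split: if_split)
  then show "reverse_alternating n p \<longleftrightarrow> descents n p = parity_positions False n"
    unfolding descents_def parity_positions_def set_eq_iff mem_Collect_eq by blast
qed

section \<open>Compositions as sets of partial sums\<close>

fun proper_prefix_sums :: "nat list \<Rightarrow> nat set" where
  "proper_prefix_sums [] = {}"
| "proper_prefix_sums (x # a) = (if a = [] then {} else insert x ((+) x ` proper_prefix_sums a))"

text \<open>The monotone colouring of positions by consecutive blocks of lengths \<open>a\<close>;
  it serves as \<open>c\<close> in the necklace bijection. Positions count from 1, hence the test
  \<open>i \<le> x\<close>.\<close>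

fun block_index :: "nat list \<Rightarrow> nat \<Rightarrow> nat" where
  "block_index [] i = 0"
| "block_index (x # a) i = (if i \<le> x then 0 else Suc (block_index a (i - x)))"

lemma block_index_mono: "i \<le> j \<Longrightarrow> block_index a i \<le> block_index a j"
  by (induction a arbitrary: i j) auto

lemma block_index_less: "0 < i \<Longrightarrow> i \<le> sum_list a \<Longrightarrow> block_index a i < length a"
  by (induction a arbitrary: i) auto

lemma card_block_index:
  "k < length a \<Longrightarrow> card {i \<in> {1..sum_list a}. block_index a i = k} = a ! k"
proof (induction a arbitrary: k)
  case (Cons x a)
  show ?case
  proof (cases k)
    case 0
    then have "{i \<in> {1..sum_list (x # a)}. block_index (x # a) i = k} = {1..x}" by auto
    then show ?thesis using 0 by simp
  next
    case (Suc k')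
    have "{i \<in> {1..sum_list (x # a)}. block_index (x # a) i = k} =
        (+) x ` {i \<in> {1..sum_list a}. block_index a i = k'}" (is "?A = ?B")
    proof (intro equalityI subsetI)
      fix i assume "i \<in> ?A"
      then show "i \<in> ?B" using Suc by (intro image_eqI[of _ _ "i - x"]) (auto split: if_splits)
    qed (use Suc in auto)
    then show ?thesis using Suc Cons by (simp add: card_image)
  qed
qed simp

lemma block_index_eq_Suc_iff:
  "0 \<notin> set a \<Longrightarrow> 1 \<le> i \<Longrightarrow> i < sum_list a \<Longrightarrow>
     block_index a i = block_index a (Suc i) \<longleftrightarrow> i \<notin> proper_prefix_sums a"
proof (induction a arbitrary: i)
  case (Cons x a)
  show ?case
  proof (cases "i > x")
    case True
    then have "block_index a (i - x) = block_index a (Suc (i - x)) \<longleftrightarrow> i - x \<notin> proper_prefix_sums a"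
      using Cons.prems by (intro Cons.IH) auto
    moreover have "i \<in> proper_prefix_sums (x # a) \<longleftrightarrow> i - x \<in> proper_prefix_sums a"
      using True Cons.prems by (cases "a = []") (auto intro!: image_eqI[of _ _ "i - x"])
    ultimately show ?thesis using True by (simp add: Suc_diff_le)
  qed (use Cons.prems in \<open>auto split: if_splits\<close>)
qed simp

text \<open>Neighbours in one block are exactly those not separated by a partial sum; the increase
  along a whole block follows step by step, since block indices are monotone.\<close>

lemma descents_subset_iff:
  assumes "p permutes {1..n}" "0 \<notin> set a" "sum_list a = n"
  shows "descents n p \<subseteq> proper_prefix_sums a \<longleftrightarrow> increasing_on_fibres n (block_index a) p"
proof
  assume sub: "descents n p \<subseteq> proper_prefix_sums a"
  have step: "p k < p (Suc k)" if "1 \<le> k" "k < n" "block_index a k = block_index a (Suc k)" for k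
  proof -
    have "k \<notin> descents n p"
      using block_index_eq_Suc_iff[of a k] assms that sub by auto
    moreover have "p k \<noteq> p (Suc k)" using injD[OF permutes_inj[OF assms(1)], of k "Suc k"] by auto
    ultimately show ?thesis using that by (auto simp: descents_def)
  qed
  have "p i < p j" if "i < j" "1 \<le> i" "j \<le> n" "block_index a i = block_index a j" for i j
    using that
  proof (induction j rule: less_induct)
    case (less j)
    then obtain k where k: "j = Suc k" by (cases j) auto
    have "block_index a i \<le> block_index a k" "block_index a k \<le> block_index a j"
      by (rule block_index_mono, use less.prems k in simp)+
    then have "p k < p j" "block_index a i = block_index a k"
      using step[of k] less.prems k by auto
    then show ?case using less.IH[of k] less.prems k by (cases "i = k") auto
  qed
  then show "increasing_on_fibres n (block_index a) p" by (auto simp: increasing_on_fibres_def)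
next
  assume inc: "increasing_on_fibres n (block_index a) p"
  show "descents n p \<subseteq> proper_prefix_sums a"
  proof
    fix i assume i: "i \<in> descents n p"
    show "i \<in> proper_prefix_sums a"
    proof (rule ccontr)
      assume "i \<notin> proper_prefix_sums a"
      then have "block_index a i = block_index a (Suc i)"
        using block_index_eq_Suc_iff[of a i] assms i by (auto simp: descents_def)
      then have "p i < p (Suc i)" using inc i by (auto simp: increasing_on_fibres_def descents_def)
      then show False using i by (simp add: descents_def)
    qed
  qed
qed

lemma proper_prefix_sums_pos:
  "0 \<notin> set a \<Longrightarrow> s \<in> proper_prefix_sums a \<Longrightarrow> s > 0"
  by (induction a arbitrary: s) (auto split: if_splits)

lemma finite_proper_prefix_sums [simp]: "finite (proper_prefix_sums a)"
  by (induction a) auto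

lemma card_proper_prefix_sums:
  "0 \<notin> set a \<Longrightarrow> card (proper_prefix_sums a) = length a - 1"
proof (induction a)
  case (Cons x a)
  have "x \<notin> (+) x ` proper_prefix_sums a"
    using proper_prefix_sums_pos[of a 0] Cons.prems by auto
  then show ?case using Cons by (cases a) (auto simp: card_image)
qed simp

lemma compositions_cases:
  assumes "a \<in> compositions e n" "n > 0"
  obtains "a = [n]" | x b where "a = x # b" "x \<in> parity_positions e n" "b \<in> compositions False (n - x)" "b \<noteq> []"
proof -
  have "a = [n] \<or> (\<exists>x b. a = x # b \<and> x \<in> parity_positions e n \<and> b \<in> compositions False (n - x))"
    using assms compositions_Cons[OF assms(2), of e] by auto
  moreover have "b \<noteq> []" if "x \<in> parity_positions e n" "b \<in> compositions False (n - x)" for x b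
    using that by (auto simp: compositions_def parity_positions_def)
  ultimately show ?thesis using that by blast
qed

lemma proper_prefix_sums_subset:
  assumes "a \<in> compositions e n" "n > 0"
  shows "proper_prefix_sums a \<subseteq> parity_positions e n"
  using assms
proof (induction n arbitrary: a e rule: less_induct)
  case (less n)
  from less.prems show ?case
  proof (cases rule: compositions_cases)
    case (2 x b)
    have x: "1 \<le> x" "x < n" "odd x \<longleftrightarrow> e" using 2 by (auto simp: parity_positions_def)
    have "proper_prefix_sums b \<subseteq> parity_positions False (n - x)"
      using x 2 by (intro less.IH) auto
    then show ?thesis using 2 x by (auto simp: parity_positions_def)
  qed simp
qed

text \<open>The first part is the minimum of the set, and the other elements, shifted back by it,
  are the partial sums of the tail.\<close>

lemma inj_on_proper_prefix_sums:
  assumes "n > 0"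
  shows "inj_on proper_prefix_sums (compositions e n)"
  using assms
proof (induction n arbitrary: e rule: less_induct)
  case (less n)
  have Min: "Min (proper_prefix_sums (x # b)) = x \<and> (+) x ` proper_prefix_sums b = proper_prefix_sums (x # b) - {x}"
    if "b \<in> compositions False k" "b \<noteq> []" for x b k
  proof -
    have "0 \<notin> set b" using that by (simp add: compositions_def)
    then have "0 \<notin> proper_prefix_sums b" using proper_prefix_sums_pos by blast
    then show ?thesis using that(2) by (auto intro!: Min_eqI)
  qed
  show ?case
  proof (rule inj_onI)
    fix a a' assume a: "a \<in> compositions e n" "a' \<in> compositions e n"
      and eq: "proper_prefix_sums a = proper_prefix_sums a'"
    from a(1) less.prems show "a = a'"
    proof (cases rule: compositions_cases)
      case 1
      from a(2) less.prems show ?thesis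
        by (cases rule: compositions_cases) (use 1 eq in auto)
    next
      case (2 x b)
      from a(2) less.prems show ?thesis
      proof (cases rule: compositions_cases)
        case 1
        then show ?thesis using 2 eq by simp
      next
        case (2 x' b')
        note A = \<open>a = x # b\<close> \<open>x \<in> parity_positions e n\<close> \<open>b \<in> compositions False (n - x)\<close> \<open>b \<noteq> []\<close>
        have x: "x = x'"
          using Min[OF A(3,4), of x] Min[OF 2(3,4), of x'] eq A(1) 2(1) by metis
        have "(+) x ` proper_prefix_sums b = (+) x ` proper_prefix_sums b'"
          using Min[OF A(3,4), of x] Min[OF 2(3,4), of x'] eq A(1) 2(1) x by metis
        then have "proper_prefix_sums b = proper_prefix_sums b'"
          by (simp add: inj_image_eq_iff)
        moreover have "inj_on proper_prefix_sums (compositions False (n - x))"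
          using A(2) by (intro less.IH) (auto simp: parity_positions_def)
        ultimately have "b = b'" using A(3) 2(3) x by (auto dest: inj_onD)
        then show ?thesis using A(1) 2(1) x by simp
      qed
    qed
  qed
qed

lemma ex_composition_proper_prefix_sums:
  assumes "n > 0" "S \<subseteq> parity_positions e n"
  shows "\<exists>a\<in>compositions e n. proper_prefix_sums a = S"
  using assms
proof (induction n arbitrary: e S rule: less_induct)
  case (less n)
  show ?case
  proof (cases "S = {}")
    case True
    then show ?thesis
      using compositions_Cons[OF less.prems(1), of e] by (intro bexI[of _ "[n]"]) auto
  next
    case False
    have fin: "finite S" using less.prems(2) finite_parity_positions finite_subset by blast
    define x where "x = Min S"
    have x: "x \<in> S" "\<And>s. s \<in> S \<Longrightarrow> x \<le> s" using False fin by (auto simp: x_def)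
    then have xT: "x \<in> parity_positions e n" using less.prems(2) by blast
    define S' where "S' = (\<lambda>s. s - x) ` (S - {x})"
    have "S' \<subseteq> parity_positions False (n - x)"
    proof
      fix t assume "t \<in> S'"
      then obtain s where s: "s \<in> S" "s \<noteq> x" "t = s - x" by (auto simp: S'_def)
      then have "s \<in> parity_positions e n" "x < s" using less.prems(2) x(2)[of s] by auto
      then show "t \<in> parity_positions False (n - x)" using xT s by (auto simp: parity_positions_def)
    qed
    then obtain b where b: "b \<in> compositions False (n - x)" "proper_prefix_sums b = S'"
      using less.IH[of "n - x" S' False] xT by (auto simp: parity_positions_def)
    have "x # b \<in> compositions e n"
      using compositions_Cons[OF less.prems(1), of e] xT b(1) by auto
    moreover have "b \<noteq> []" using b(1) xT by (auto simp: compositions_def parity_positions_def)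
    moreover have "(+) x ` S' = S - {x}"
      unfolding S'_def image_image using x by (force simp: image_iff)
    ultimately show ?thesis using b(2) x(1) by (intro bexI[of _ "x # b"]) auto
  qed
qed

lemma bij_betw_proper_prefix_sums:
  assumes "n > 0"
  shows "bij_betw proper_prefix_sums (compositions e n) (Pow (parity_positions e n))"
  unfolding bij_betw_def
proof (intro conjI inj_on_proper_prefix_sums[OF assms] equalityI subsetI)
  fix S assume "S \<in> Pow (parity_positions e n)"
  then show "S \<in> proper_prefix_sums ` compositions e n"
    using ex_composition_proper_prefix_sums[OF assms, of S e] by blast
qed (use proper_prefix_sums_subset[OF _ assms] in blast)

text \<open>Read over subsets, this is inclusion-exclusion: a composition has one part more than
  interior partial sums, so the sign in \<open>ribbon\<close> is the parity of the number of omitted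
  positions.\<close>

lemma ribbon_indicator_descents:
  assumes "n > 0" "D \<subseteq> {1..<n}"
  shows "ribbon e n (\<lambda>a. of_bool (D \<subseteq> proper_prefix_sums a)) = of_bool (D = parity_positions e n)"
proof -
  let ?T = "parity_positions e n"
  have "ribbon e n (\<lambda>a. of_bool (D \<subseteq> proper_prefix_sums a)) =
      (\<Sum>a\<in>compositions e n. (-1) ^ (card ?T - card (proper_prefix_sums a)) * of_bool (D \<subseteq> proper_prefix_sums a))"
    unfolding ribbon_def
  proof (intro sum.cong refl arg_cong2[where f = times])
    fix a assume a: "a \<in> compositions e n"
    have "card (proper_prefix_sums a) \<le> card ?T"
      using proper_prefix_sums_subset[OF a assms(1)] by (intro card_mono) auto
    moreover have "length a = card (proper_prefix_sums a) + 1"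
      using card_proper_prefix_sums[of a] a compositions_pos_length[OF a assms(1)] by (simp add: compositions_def)
    ultimately have "card ?T + length a + 1 = (card ?T - card (proper_prefix_sums a)) + 2 * (card (proper_prefix_sums a) + 1)"
      by simp
    then show "(-1) ^ (card ?T + length a + 1) = ((-1) ^ (card ?T - card (proper_prefix_sums a)) :: real)"
      by (simp only: power_add power_mult) simp
  qed
  also have "\<dots> = (\<Sum>S\<in>Pow ?T. (-1) ^ (card ?T - card S) * of_bool (D \<subseteq> S))"
    by (rule sum.reindex_bij_betw[OF bij_betw_proper_prefix_sums[OF assms(1)]])
  also have "\<dots> = of_bool (D = ?T)"
  proof (cases "D \<subseteq> ?T")
    case True
    \<comment> \<open>The factor at \<open>x\<close> is 1 if \<open>x \<in> D\<close> and 0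
      otherwise; expanding the product yields the alternating sum.\<close>
    have "(\<Prod>x\<in>?T. 1 - of_bool (x \<notin> D)) =
        (\<Sum>S\<in>Pow ?T. (-1) ^ (card ?T - card S) * (\<Prod>x\<in>S. 1) * (\<Prod>x\<in>?T - S. of_bool (x \<notin> D) :: real))"
      by (rule prod_diff_conv_sum') simp
    also have "\<dots> = (\<Sum>S\<in>Pow ?T. (-1) ^ (card ?T - card S) * of_bool (D \<subseteq> S))"
    proof (intro sum.cong refl)
      fix S assume "S \<in> Pow ?T"
      have "(\<Prod>x\<in>?T - S. of_bool (x \<notin> D) :: real) = of_bool (D \<subseteq> S)"
      proof (cases "D \<subseteq> S")
        case True
        then show ?thesis by (auto intro!: prod.neutral)
      next
        case False
        then obtain x where "x \<in> D" "x \<notin> S" by blast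
        then show ?thesis using \<open>D \<subseteq> ?T\<close> False by (auto intro!: prod_zero bexI[of _ x])
      qed
      then show "(-1) ^ (card ?T - card S) * (\<Prod>x\<in>S. 1) * (\<Prod>x\<in>?T - S. of_bool (x \<notin> D) :: real) =
          (-1) ^ (card ?T - card S) * of_bool (D \<subseteq> S)" by simp
    qed
    also have "(\<Prod>x\<in>?T. 1 - of_bool (x \<notin> D) :: real) = of_bool (D = ?T)"
    proof (cases "D = ?T")
      case False
      then obtain x where "x \<in> ?T" "x \<notin> D" using True by blast
      then show ?thesis using False by (auto intro!: prod_zero bexI[of _ x])
    qed (simp add: prod.neutral)
    finally show ?thesis by simp
  next
    case False
    then have "\<not> D \<subseteq> S" if "S \<in> Pow ?T" for S using that by blast
    then show ?thesis using False by auto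
  qed
  finally show ?thesis .
qed

subsection \<open>Umbral evaluation\<close>

text \<open>Permutations with descents inside the partial sums of \<open>a\<close> increase on the
  blocks of \<open>a\<close>, hence number \<open>necklace_count m a\<close>. Since
  \<open>ribbon\<close> is linear, it can be applied to the indicator of each permutation
  separately.\<close>

lemma card_uniform_perms_descents:
  assumes "m > 0" "n > 0"
  shows "real (card {p \<in> uniform_perms m n. descents n p = parity_positions e n}) = ribbon e n (necklace_count m)"
proof -
  let ?U = "uniform_perms m n"
  have fin: "finite ?U"
    by (rule finite_subset[OF _ finite_permutations[of "{1..n}"]]) (auto simp: uniform_perms_def)
  have count: "real (card {p \<in> ?U. descents n p \<subseteq> proper_prefix_sums a}) = necklace_count m a"
    if "a \<in> compositions e n" for a
  proof -
    have a: "0 \<notin> set a" "sum_list a = n" using that by (auto simp: compositions_def)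
    have "{p \<in> ?U. descents n p \<subseteq> proper_prefix_sums a} = {p \<in> ?U. increasing_on_fibres n (block_index a) p}"
      using descents_subset_iff[OF uniform_permsD(1) a] by blast
    moreover have "bij_betw (\<lambda>p w. card {i \<in> {1..n}. itinerary m (block_index a) p i = w})
        {p \<in> ?U. increasing_on_fibres n (block_index a) p} (necklace_multisets m a)"
      using block_index_mono block_index_less[of _ a] card_block_index[of _ a] a(2)
      by (intro bij_betw_necklace_multisets assms) auto
    ultimately show ?thesis
      by (simp only: necklace_count_def bij_betw_same_card)
  qed
  have "real (card {p \<in> ?U. descents n p = parity_positions e n}) =
      (\<Sum>p\<in>?U. of_bool (descents n p = parity_positions e n))"
    using fin by (simp add: Int_def)
  also have "\<dots> = (\<Sum>p\<in>?U. ribbon e n (\<lambda>a. of_bool (descents n p \<subseteq> proper_prefix_sums a)))"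
    by (intro sum.cong refl, subst ribbon_indicator_descents[OF assms(2)]) (auto simp: descents_def)
  also have "\<dots> = ribbon e n (\<lambda>a. \<Sum>p\<in>?U. of_bool (descents n p \<subseteq> proper_prefix_sums a))"
    by (rule ribbon_sum[symmetric])
  also have "\<dots> = ribbon e n (necklace_count m)"
    unfolding ribbon_def
    by (intro sum.cong refl, subst count[symmetric]) (use fin in \<open>simp_all add: Int_def\<close>)
  finally show ?thesis .
qed

lemma real_b_alt:
  assumes "m > 0" "r > 0"
  shows "real (b_alt m r) = ribbon True (m * r) (necklace_count m)"
    and "real (b_star m r) = ribbon False (m * r) (necklace_count m)"
proof -
  have alt: "{p. p permutes {1..m * r} \<and> alternating (m * r) p \<and> (\<forall>C\<in>perm_cycles (m * r) p. card C = m)} =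
      {p \<in> uniform_perms m (m * r). descents (m * r) p = parity_positions True (m * r)}"
    unfolding uniform_perms_eq_cycles[OF assms(1)] using alternating_iff_descents(1) by blast
  have rev: "{p. p permutes {1..m * r} \<and> reverse_alternating (m * r) p \<and> (\<forall>C\<in>perm_cycles (m * r) p. card C = m)} =
      {p \<in> uniform_perms m (m * r). descents (m * r) p = parity_positions False (m * r)}"
    unfolding uniform_perms_eq_cycles[OF assms(1)] using alternating_iff_descents(2) by blast
  show "real (b_alt m r) = ribbon True (m * r) (necklace_count m)"
    and "real (b_star m r) = ribbon False (m * r) (necklace_count m)"
    using assms card_uniform_perms_descents[of m "m * r"]
    by (simp_all only: b_alt_def b_star_def alt rev nat_0_less_mult_iff simp_thms)
qed

lemma b_alt_0: "b_alt m 0 = 1" "b_star m 0 = 1"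
  by (simp_all add: b_alt_def b_star_def alternating_def reverse_alternating_def perm_cycles_def permutes_empty)

section \<open>Linearity of umbral evaluation and the recurrence for odd \<open>m\<close>\<close>

text \<open>The bound in the definition varies with the polynomial; additivity needs a common
  one.\<close>

lemma umbral_eval_poly_eq:
  assumes "degree q \<le> n"
  shows "umbral_eval_poly q = (\<Sum>k\<le>n. coeff q k * euler_number k)"
  unfolding umbral_eval_poly_def using assms
  by (intro sum.mono_neutral_left) (auto simp: coeff_eq_0)

lemma umbral_eval_poly_add: "umbral_eval_poly (p + q) = umbral_eval_poly p + umbral_eval_poly q"
proof -
  let ?n = "max (degree p) (degree q)"
  have "umbral_eval_poly (p + q) = (\<Sum>k\<le>?n. coeff (p + q) k * euler_number k)"
    by (rule umbral_eval_poly_eq) (rule degree_add_le_max)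
  also have "\<dots> = umbral_eval_poly p + umbral_eval_poly q"
    by (simp add: umbral_eval_poly_eq[of p ?n] umbral_eval_poly_eq[of q ?n] distrib_right sum.distrib)
  finally show ?thesis .
qed

lemma umbral_eval_poly_0 [simp]: "umbral_eval_poly 0 = 0"
  by (simp add: umbral_eval_poly_def)

lemma umbral_eval_poly_smult: "umbral_eval_poly (smult c p) = c * umbral_eval_poly p"
  by (simp add: umbral_eval_poly_eq[of "smult c p" "degree p"] degree_smult_le umbral_eval_poly_def
      sum_distrib_left mult.assoc)

lemma umbral_eval_poly_sum: "umbral_eval_poly (\<Sum>x\<in>X. f x) = (\<Sum>x\<in>X. umbral_eval_poly (f x))"
  by (induction X rule: infinite_finite_induct) (simp_all add: umbral_eval_poly_add)

lemma umbral_eval_poly_monom: "umbral_eval_poly (monom c k) = c * euler_number k"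
proof -
  have "umbral_eval_poly (monom c k) = (\<Sum>j\<le>k. coeff (monom c k) j * euler_number j)"
    by (rule umbral_eval_poly_eq) (rule degree_monom_le)
  also have "\<dots> = (\<Sum>j\<le>k. if j = k then c * euler_number k else 0)"
    by (intro sum.cong) auto
  finally show ?thesis by simp
qed

lemma ribbon_psum_mult_2_odd_power:
  assumes g: "zero_insertion_invariant n g" and "odd q"
  shows "ribbon e (n + 2 * q) ((psum_mult 2 ^^ q) g) = ribbon e (n + 2) (psum_mult 2 g)"
proof -
  let ?c = "of_bool (\<not> e) + of_bool (odd n \<longleftrightarrow> e) - 1 :: real"
  have step: "ribbon e (n + 2 * Suc k) ((psum_mult 2 ^^ Suc k) g) =
      ?c * ribbon e (n + 2 * k) ((psum_mult 2 ^^ k) g)" if "n + 2 * k > 0" for k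
  proof -
    have "zero_insertion_invariant (n + 2 * k) ((psum_mult 2 ^^ k) g)"
      using zero_insertion_invariant_psum_mult_funpow[OF g, of 2 k] by (simp add: add.commute mult.commute)
    from ribbon_psum_mult_2[OF that this, of e] show ?thesis by (simp add: add_ac)
  qed
  show ?thesis
  proof (cases "odd n")
    case True
    then have zero: "ribbon e (n + 2 * Suc k) ((psum_mult 2 ^^ Suc k) g) = 0" for k
      using step[of k] odd_pos[OF True] by (cases e) auto
    obtain k where "q = Suc k" using \<open>odd q\<close> by (cases q) auto
    then show ?thesis using zero[of k] zero[of 0] by simp
  next
    case False
    then have c: "?c * ?c = 1" by auto
    obtain k where q: "q = 2 * k + 1" using \<open>odd q\<close> by (rule oddE)
    have "ribbon e (n + 2 * (2 * k + 1)) ((psum_mult 2 ^^ (2 * k + 1)) g) = ribbon e (n + 2) (psum_mult 2 g)"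
    proof (induction k)
      case (Suc k)
      have "ribbon e (n + 2 * (2 * Suc k + 1)) ((psum_mult 2 ^^ (2 * Suc k + 1)) g) =
          ?c * ribbon e (n + 2 * Suc (2 * k + 1)) ((psum_mult 2 ^^ Suc (2 * k + 1)) g)"
        using step[of "Suc (2 * k + 1)"] by simp
      also have "\<dots> = ?c * (?c * ribbon e (n + 2 * (2 * k + 1)) ((psum_mult 2 ^^ (2 * k + 1)) g))"
        using step[of "2 * k + 1"] by simp
      also have "\<dots> = ribbon e (n + 2) (psum_mult 2 g)"
        unfolding mult.assoc[symmetric] c using Suc.IH by simp
      finally show ?case .
    qed (simp add: One_nat_def)
    then show ?thesis using q by simp
  qed
qed

text \<open>The coefficient in the exponent without its factor \<open>1 / m\<close>; that factor is
  matched by the \<open>m\<close> in \<open>r * m\<close> on the left of Newton's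
  recurrence.\<close>

definition cycle_exponent :: "nat \<Rightarrow> real poly" where
  "cycle_exponent m = (\<Sum>d | d dvd m. smult (of_int (moebius_mu d) * (-1) ^ ((d - 1) div 2)) (monom 1 (m div d)))"

text \<open>For odd \<open>k\<close>, \<open>(-1) ^ ((k - 1) div 2)\<close> is the nontrivial
  character modulo 4, hence multiplicative; an odd power does not change a sign.\<close>

lemma minus_one_power_odd_mult:
  assumes "odd k" "odd d" "odd q"
  shows "(-1) ^ (q * ((k * d - 1) div 2)) = ((-1) ^ ((k - 1) div 2) * (-1) ^ ((d - 1) div 2) :: real)"
proof -
  obtain a where a: "k = 2 * a + 1" using assms(1) by (rule oddE)
  obtain b where b: "d = 2 * b + 1" using assms(2) by (rule oddE)
  have "k * d - 1 = 2 * (2 * a * b + a + b)" by (simp add: a b algebra_simps)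
  then have "(k * d - 1) div 2 = 2 * a * b + a + b" by simp
  moreover have "even (q * (2 * a * b + a + b)) \<longleftrightarrow> even (a + b)" using assms(3) by auto
  ultimately show ?thesis by (simp add: a b power_add[symmetric] minus_one_power_iff)
qed

text \<open>Degree 0 is excluded because \<open>ribbon\<close> gives the empty composition the sign
  \<open>-1\<close>. For \<open>r = 0\<close> only \<open>p_1 ^ l\<close> remains and the value is
  an Euler number.\<close>

lemma ribbon_necklace_count:
  assumes m: "odd m" "m > 1" and Q0: "Q 0 = 1"
    and Q: "\<And>r. of_nat (r * m) * Q r = (\<Sum>k=1..r. if odd k then smult ((-1) ^ ((k - 1) div 2)) (cycle_exponent m * Q (r - k)) else 0)"
    and "l + r > 0"
  shows "ribbon e (l + r * m) ((psum_mult 1 ^^ l) (necklace_count m)) = umbral_eval_poly (monom 1 l * Q r)"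
  using assms(5)
proof (induction r arbitrary: l rule: less_induct)
  case (less r)
  let ?A = "necklace_count m"
  let ?P = "psum_mult"
  show ?case
  proof (cases "r = 0")
    case True
    have "ribbon e l ((?P 1 ^^ l) ?A) = ribbon e l ((?P 1 ^^ l) const_coeff)"
      using m by (intro ribbon_cong psum_mult_funpow_cong) (auto simp: necklace_count_sum_0 const_coeff_def)
    then show ?thesis using True less.prems ribbon_psum_mult_1[of l e]
      by (simp add: Q0 umbral_eval_poly_monom)
  next
    case False
    define n where "n = l + r * m"
    define T where "T k d = ribbon e n ((?P 1 ^^ l) ((?P (k * d) ^^ (m div d)) ?A))" for k d
    have "real (r * m) * ribbon e n ((?P 1 ^^ l) ?A) = ribbon e n ((?P 1 ^^ l) (\<lambda>b. real (r * m) * ?A b))"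
      by (simp only: psum_mult_funpow_cmult ribbon_cmult)
    also have "\<dots> = ribbon e n ((?P 1 ^^ l)
        (\<lambda>b. \<Sum>k=1..r. \<Sum>d | d dvd m. of_int (moebius_mu d) * (?P (k * d) ^^ (m div d)) ?A b))"
    proof (intro ribbon_cong psum_mult_funpow_cong)
      fix a b :: "nat list" assume "sum_list a = n" "sum_list b + l * 1 = sum_list a"
      then have b: "sum_list b = r * m" by (simp add: n_def)
      have "real (r * m) * ?A b =
          (\<Sum>k=1..r * m. \<Sum>d | d dvd m. of_int (moebius_mu d) * (?P (k * d) ^^ (m div d)) ?A b)"
        using necklace_count_rec[of m b] m b by simp
      \<comment> \<open>For \<open>k > r\<close> the factor \<open>p_(k d) ^ (m / d)\<close> has
        degree \<open>k * m\<close>, which exceeds the degree \<open>r * m\<close> of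
        \<open>b\<close>.\<close>
      also have "\<dots> = (\<Sum>k=1..r. \<Sum>d | d dvd m. of_int (moebius_mu d) * (?P (k * d) ^^ (m div d)) ?A b)"
      proof (rule sum.mono_neutral_right)
        show "\<forall>k\<in>{1..r * m} - {1..r}. (\<Sum>d | d dvd m. of_int (moebius_mu d) * (?P (k * d) ^^ (m div d)) ?A b) = 0"
        proof (intro ballI sum.neutral)
          fix k d assume "k \<in> {1..r * m} - {1..r}" "d \<in> {d. d dvd m}"
          then have eq: "(m div d) * (k * d) = m * k" and "r < k" by (auto simp: mult_ac)
          then have "sum_list b < (m div d) * (k * d)" unfolding eq using b m by simp
          then show "of_int (moebius_mu d) * (?P (k * d) ^^ (m div d)) ?A b = 0"
            by (simp add: psum_mult_funpow_eq_0)
        qed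
      qed (use m in auto)
      finally show "real (r * m) * ?A b =
          (\<Sum>k=1..r. \<Sum>d | d dvd m. of_int (moebius_mu d) * (?P (k * d) ^^ (m div d)) ?A b)" .
    qed
    also have "\<dots> = (\<Sum>k=1..r. \<Sum>d | d dvd m. of_int (moebius_mu d) * T k d)"
      by (simp only: psum_mult_funpow_sum psum_mult_funpow_cmult ribbon_sum ribbon_cmult T_def)
    also have "\<dots> = (\<Sum>k=1..r. if odd k then (-1) ^ ((k - 1) div 2) *
        umbral_eval_poly (monom 1 l * (cycle_exponent m * Q (r - k))) else 0)"
    proof (intro sum.cong refl)
      fix k assume "k \<in> {1..r}"
      then have k: "1 \<le> k" "k \<le> r" by auto
      define n0 where "n0 = l + (r - k) * m"
      have d_facts: "odd d" "odd (m div d)" "n = n0 + (m div d) * (k * d)" "d > 0"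
        if "d dvd m" for d
      proof -
        from that obtain q where q: "m = d * q" by (rule dvdE)
        show "odd d" "d > 0" using q m by (auto intro: Nat.gr0I)
        then have "m div d = q" using q by simp
        then show "odd (m div d)" using q m by simp
        have "r * m = (r - k) * m + k * m"
          using k by (simp add: distrib_right[symmetric])
        then have "n = n0 + k * m" by (simp add: n_def n0_def)
        then show "n = n0 + (m div d) * (k * d)" using q \<open>m div d = q\<close> by (simp add: mult_ac)
      qed
      have T: "T k d = ribbon e (n0 + (m div d) * (k * d)) ((?P (k * d) ^^ (m div d)) ((?P 1 ^^ l) ?A))"
        if "d dvd m" for d
        unfolding T_def d_facts(3)[OF that, symmetric]
        by (rule arg_cong[OF psum_mult_funpow_commute])
      show "(\<Sum>d | d dvd m. of_int (moebius_mu d) * T k d) = (if odd k then (-1) ^ ((k - 1) div 2) *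
          umbral_eval_poly (monom 1 l * (cycle_exponent m * Q (r - k))) else 0)"
      proof (cases "odd k")
        case True
        have Tk: "T k d = (-1) ^ ((k - 1) div 2) * (-1) ^ ((d - 1) div 2) *
            umbral_eval_poly (monom 1 (l + m div d) * Q (r - k))" if d: "d dvd m" for d
        proof -
          let ?q = "m div d" and ?i = "(k * d - 1) div 2"
          have kd: "k * d = 1 + 2 * ?i"
            using True d_facts(1)[OF d] by (auto elim!: oddE)
          \<comment> \<open>Each of the \<open>?q\<close> factors \<open>p_(k d)\<close> descends to
            \<open>p_1\<close> in \<open>?i\<close> steps of size 2.\<close>
          have "T k d = (-1) ^ (?q * ?i) * ribbon e (n0 + ?q * 1) ((?P 1 ^^ ?q) ((?P 1 ^^ l) ?A))"
            using ribbon_psum_mult_funpow_add_even[of 1 e n0 ?q ?i "(?P 1 ^^ l) ?A"] T[OF d]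
            unfolding kd[symmetric] by simp
          also have "(?P 1 ^^ ?q) ((?P 1 ^^ l) ?A) = (?P 1 ^^ (l + ?q)) ?A"
            by (simp only: add.commute[of l] funpow_add o_apply)
          also have "n0 + ?q * 1 = (l + ?q) + (r - k) * m"
            by (simp add: n0_def)
          also have "ribbon e \<dots> ((?P 1 ^^ (l + ?q)) ?A) = umbral_eval_poly (monom 1 (l + ?q) * Q (r - k))"
          proof (rule less.IH)
            \<comment> \<open>The new factors \<open>p_1\<close> keep the degree positive even for
              \<open>l = 0\<close> and \<open>k = r\<close>.\<close>
            show "0 < l + ?q + (r - k)" using d_facts(2)[OF d] by (simp add: odd_pos)
          qed (use k in auto)
          finally show ?thesis
            using minus_one_power_odd_mult[OF True d_facts(1,2)[OF d]] by simp
        qed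
        have "monom 1 l * (cycle_exponent m * Q (r - k)) =
            (\<Sum>d | d dvd m. smult (of_int (moebius_mu d) * (-1) ^ ((d - 1) div 2)) (monom 1 (l + m div d) * Q (r - k)))"
          by (simp add: cycle_exponent_def sum_distrib_left sum_distrib_right mult_monom mult.assoc[symmetric])
        then show ?thesis using True Tk
          by (simp add: umbral_eval_poly_sum umbral_eval_poly_smult sum_distrib_left mult_ac)
      next
        case False
        let ?R = "ribbon e (n0 + 2) (?P 2 ((?P 1 ^^ l) ?A))"
        \<comment> \<open>For even \<open>k\<close> all factors descend to \<open>p_2\<close>. As
          \<open>d\<close> and \<open>m div d\<close> are odd, neither the sign nor the remaining
          value depends on \<open>d\<close>, so the divisor sum is a multiple of the Moebius
          sum.\<close>
        have Tk: "T k d = (-1) ^ (k div 2 - 1) * ?R" if d: "d dvd m" for d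
        proof -
          let ?q = "m div d" and ?i = "k div 2 * d - 1"
          have k2: "k div 2 > 0" "k = 2 * (k div 2)" using False k by (auto elim!: evenE)
          then have "k div 2 * d > 0" using d_facts(4)[OF d] by simp
          then have "2 + 2 * ?i = 2 * (k div 2 * d)" by linarith
          also have "\<dots> = k * d" using k2(2) by (metis mult.assoc)
          finally have kd: "2 + 2 * ?i = k * d" .
          have "T k d = (-1) ^ (?q * ?i) * ribbon e (n0 + ?q * 2) ((?P 2 ^^ ?q) ((?P 1 ^^ l) ?A))"
            using ribbon_psum_mult_funpow_add_even[of 2 e n0 ?q ?i "(?P 1 ^^ l) ?A"] T[OF d]
            unfolding kd by simp
          also have "ribbon e (n0 + ?q * 2) ((?P 2 ^^ ?q) ((?P 1 ^^ l) ?A)) = ?R"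
          proof -
            have "zero_insertion_invariant n0 ((?P 1 ^^ l) ?A)"
              using zero_insertion_invariant_psum_mult_funpow[OF zero_insertion_invariant_necklace_count[of m "(r - k) * m"], of 1 l] m
              by (simp add: n0_def)
            from ribbon_psum_mult_2_odd_power[OF this d_facts(2)[OF d], of e]
            show ?thesis by (simp add: mult.commute)
          qed
          also have "(-1) ^ (?q * ?i) = ((-1) ^ (k div 2 - 1) :: real)"
          proof -
            have "even (?q * ?i) \<longleftrightarrow> even ?i" using d_facts(2)[OF d] by simp
            also have "\<dots> \<longleftrightarrow> even (k div 2 - 1)"
              using k2(1) d_facts(1)[OF d] \<open>k div 2 * d > 0\<close> by simp
            finally show ?thesis by (simp add: minus_one_power_iff)
          qed
          finally show ?thesis .
        qed
        have "(\<Sum>d | d dvd m. of_int (moebius_mu d) * T k d) =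
            of_int (\<Sum>d | d dvd m. moebius_mu d) * ((-1) ^ (k div 2 - 1) * ?R)"
          using Tk by (simp add: sum_distrib_right)
        also have "\<dots> = 0" using sum_moebius_mu[of m] m by simp
        finally show ?thesis using False by simp
      qed
    qed
    also have "\<dots> = umbral_eval_poly (monom 1 l * (of_nat (r * m) * Q r))"
      unfolding Q sum_distrib_left umbral_eval_poly_sum
      by (intro sum.cong refl) (simp add: umbral_eval_poly_smult)
    also have "\<dots> = umbral_eval_poly (smult (real (r * m)) (monom 1 l * Q r))"
      by (simp add: of_nat_poly mult_ac del: of_nat_mult)
    also have "\<dots> = real (r * m) * umbral_eval_poly (monom 1 l * Q r)"
      by (rule umbral_eval_poly_smult)
    finally show ?thesis using False m by (simp add: n_def)
  qed
qed

section \<open>Series over polynomials in \<open>E\<close>\<close>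

lemma const_in_E_nth [simp]: "fps_nth (const_in_E f) n = [:fps_nth f n:]"
  by (simp add: const_in_E_def)

lemma const_poly_sum: "[:\<Sum>x\<in>X. f x:] = (\<Sum>x\<in>X. [:f x:])"
proof (induction X rule: infinite_finite_induct)
  case (insert x F)
  have "[:f x + sum f F:] = [:f x:] + [:sum f F:]" by simp
  then show ?case by (simp only: sum.insert[OF insert.hyps] insert.IH)
qed simp_all

lemma const_in_E_mult: "const_in_E (f * g) = const_in_E f * const_in_E g"
  by (rule fps_ext) (simp add: fps_mult_nth const_poly_sum mult.commute)

lemma const_in_E_1: "const_in_E 1 = 1"
  by (rule fps_ext) (simp add: fps_one_nth)

lemma const_in_E_power: "const_in_E (f ^ k) = const_in_E f ^ k"
  by (induction k) (simp_all add: const_in_E_1 const_in_E_mult)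

lemma fps_deriv_const_in_E_exp: "fps_deriv (const_in_E (fps_exp 1)) = const_in_E (fps_exp 1)"
proof (rule fps_ext)
  fix n
  have "real (Suc n) / fact (Suc n) = 1 / fact n"
    by (simp only: fact_Suc of_nat_mult) (simp del: of_nat_Suc)
  then show "fps_nth (fps_deriv (const_in_E (fps_exp 1))) n = fps_nth (const_in_E (fps_exp 1)) n"
    by (simp add: of_nat_poly del: of_nat_Suc fact_Suc)
qed

lemma fps_deriv_arctan_nth: "fps_nth (fps_deriv fps_arctan) n = (if even n then (-1) ^ (n div 2) else 0)"
  by (simp add: fps_arctan_def del: of_nat_Suc)

lemma fps_deriv_const_in_E: "fps_deriv (const_in_E f) = const_in_E (fps_deriv f)"
  by (rule fps_ext) (simp add: of_nat_poly del: of_nat_Suc)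

text \<open>Coefficients of \<open>H' = C arctan' H\<close>. Only even coefficients of
  \<open>arctan'\<close> are nonzero, and the shift by one from the derivative turns them into odd
  \<open>k\<close>.\<close>

lemma exp_arctan_rec:
  fixes C :: "real poly"
  defines "Q \<equiv> fps_nth (const_in_E (fps_exp 1) oo (fps_const C * const_in_E fps_arctan))"
  shows "Q 0 = 1"
    and "of_nat r * Q r = (\<Sum>k=1..r. if odd k then smult ((-1) ^ ((k - 1) div 2)) (C * Q (r - k)) else 0)"
proof -
  let ?G = "fps_const C * const_in_E fps_arctan"
  let ?H = "const_in_E (fps_exp 1) oo ?G"
  have G0: "fps_nth ?G 0 = 0" by (simp add: fps_arctan_def)
  show "Q 0 = 1" by (simp add: Q_def one_pCons)
  have "fps_deriv ?H = (fps_deriv (const_in_E (fps_exp 1)) oo ?G) * fps_deriv ?G"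
    by (rule fps_compose_deriv[OF G0])
  then have dH: "fps_deriv ?H = fps_const C * (const_in_E (fps_deriv fps_arctan) * ?H)"
    by (simp add: fps_deriv_const_in_E_exp fps_deriv_const_in_E mult_ac)
  show "of_nat r * Q r = (\<Sum>k=1..r. if odd k then smult ((-1) ^ ((k - 1) div 2)) (C * Q (r - k)) else 0)"
  proof (cases r)
    case (Suc s)
    have "of_nat r * Q r = fps_nth (fps_deriv ?H) s"
      by (simp add: Suc Q_def)
    also have "\<dots> = (\<Sum>i=0..s. C * ([:if even i then (-1) ^ (i div 2) else 0:] * Q (s - i)))"
      unfolding dH fps_mult_left_const_nth
      by (simp add: fps_mult_nth[of "const_in_E _"] sum_distrib_left fps_deriv_arctan_nth Q_def del: fps_deriv_nth)
    also have "\<dots> = (\<Sum>k=1..r. if odd k then smult ((-1) ^ ((k - 1) div 2)) (C * Q (r - k)) else 0)"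
      by (rule sum.reindex_bij_witness[of _ "\<lambda>k. k - 1" Suc]) (auto simp: Suc)
    finally show ?thesis .
  qed simp
qed

lemma umbral_E_power: "umbral_E ^ k = fps_const (monom 1 k)"
  by (simp add: umbral_E_def fps_const_power monom_power)

lemma cycle_poly_eq: "cycle_poly m = fps_const (smult (1 / real m) (cycle_exponent m))"
proof -
  have sum: "fps_const (\<Sum>x\<in>X. f x) = (\<Sum>x\<in>X. fps_const (f x))" for X and f :: "nat \<Rightarrow> real poly"
    by (induction X rule: infinite_finite_induct) (simp_all add: fps_const_add[symmetric] del: fps_const_add)
  show ?thesis
    by (simp add: cycle_poly_def cycle_exponent_def umbral_E_power sum[symmetric])
qed

lemma smult_sum: "smult c (\<Sum>x\<in>X. f x) = (\<Sum>x\<in>X. smult c (f x))"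
  by (induction X rule: infinite_finite_induct) (simp_all add: smult_add_right)

text \<open>The \<open>k\<close>-th power of \<open>E arctan t\<close> contains only
  \<open>E ^ k\<close>, so evaluation amounts to multiplying the \<open>k\<close>-th coefficient of
  \<open>f\<close> by \<open>E_k\<close> before composing.\<close>

lemma umbral_eval_compose_arctan:
  "umbral_eval (const_in_E f oo (umbral_E * const_in_E fps_arctan)) =
     Abs_fps (\<lambda>k. fps_nth f k * euler_number k) oo fps_arctan"
proof (rule fps_ext)
  fix n
  have eq: "fps_nth (const_in_E f oo (umbral_E * const_in_E fps_arctan)) n =
      (\<Sum>k=0..n. smult (fps_nth f k * fps_nth (fps_arctan ^ k) n) (monom 1 k))"
    by (simp add: fps_compose_nth power_mult_distrib umbral_E_power const_in_E_power[symmetric] mult.commute)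
  show "fps_nth (umbral_eval (const_in_E f oo (umbral_E * const_in_E fps_arctan))) n =
      fps_nth (Abs_fps (\<lambda>k. fps_nth f k * euler_number k) oo fps_arctan) n"
    unfolding umbral_eval_def fps_nth_Abs_fps eq
    by (simp add: umbral_eval_poly_sum umbral_eval_poly_smult umbral_eval_poly_monom
        fps_compose_nth mult_ac)
qed

lemma umbral_eval_const_mult: "umbral_eval (const_in_E f * g) = f * umbral_eval g"
  by (rule fps_ext) (simp add: umbral_eval_def fps_mult_nth umbral_eval_poly_sum umbral_eval_poly_smult)

lemma umbral_eval_add: "umbral_eval (f + g) = umbral_eval f + umbral_eval g"
  by (rule fps_ext) (simp add: umbral_eval_def umbral_eval_poly_add)

section \<open>The case \<open>m = 1\<close>\<close>

text \<open>Weighting by Euler numbers turns sinh and cosh into the odd and even parts of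
  \<open>sec + tan\<close>. Since cos is even, \<open>cos (sec + tan) = 1 + sin\<close> splits by
  parity into the two claims.\<close>

lemma cos_mult_umbral_sinh_cosh:
  "fps_cos 1 * Abs_fps (\<lambda>k. fps_nth fps_sinh k * euler_number k) = fps_sin 1"
  "fps_cos 1 * Abs_fps (\<lambda>k. fps_nth fps_cosh k * euler_number k) = 1"
proof -
  let ?U = "inverse (fps_cos 1) + fps_tan 1 :: real fps"
  let ?S = "Abs_fps (\<lambda>k. fps_nth fps_sinh k * euler_number k)"
  let ?C = "Abs_fps (\<lambda>k. fps_nth fps_cosh k * euler_number k)"
  have eq: "fps_cos 1 * ?U = 1 + fps_sin 1"
    by (simp add: fps_tan_def fps_divide_unit ring_distribs inverse_mult_eq_1' mult_ac)
  have S: "fps_nth ?S k = (if odd k then fps_nth ?U k else 0)"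
    and C: "fps_nth ?C k = (if even k then fps_nth ?U k else 0)" for k
    by (simp_all add: fps_sinh_def fps_cosh_def euler_number_def)
  have cos: "fps_nth (fps_cos 1) i = (0 :: real)" if "odd i" for i
    using that by (simp add: fps_cos_def)
  have "fps_nth (fps_cos 1 * ?S) n = (if odd n then fps_nth (fps_cos 1 * ?U) n else 0)" for n
    unfolding fps_mult_nth S by (auto intro!: sum.cong sum.neutral simp: cos)
  then show "fps_cos 1 * ?S = fps_sin 1"
    unfolding eq by (intro fps_ext) (auto simp: fps_sin_def)
  have "fps_nth (fps_cos 1 * ?C) n = (if even n then fps_nth (fps_cos 1 * ?U) n else 0)" for n
    unfolding fps_mult_nth C by (auto intro!: sum.cong sum.neutral simp: cos)
  then show "fps_cos 1 * ?C = 1"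
    unfolding eq by (intro fps_ext) (auto simp: fps_sin_def)
qed

lemma fps_deriv_arctan: "(1 + fps_X ^ 2) * fps_deriv fps_arctan = 1"
proof (rule fps_ext)
  fix n
  show "fps_nth ((1 + fps_X ^ 2) * fps_deriv fps_arctan) n = fps_nth 1 n"
  proof (cases "n < 2")
    case True
    then show ?thesis by (auto simp: distrib_right fps_X_power_mult_nth fps_deriv_arctan_nth less_2_cases_iff simp del: fps_deriv_nth)
  next
    case False
    then obtain k where "n = k + 2" by (metis add.commute le_Suc_ex not_less)
    then show ?thesis by (simp add: distrib_right fps_X_power_mult_nth fps_deriv_arctan_nth del: fps_deriv_nth)
  qed
qed

text \<open>The difference \<open>y\<close> of the sides satisfies \<open>(1 + t^2) y' = t y\<close>
  and \<open>y(0) = 0\<close>; the equation determines every coefficient by earlier ones.\<close>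

lemma sin_compose_arctan: "fps_sin 1 oo fps_arctan = fps_X * (fps_cos 1 oo fps_arctan)"
proof -
  let ?A = fps_arctan
  let ?s = "fps_sin 1 oo ?A" and ?c = "fps_cos 1 oo ?A"
  define y where "y = ?s - fps_X * ?c"
  have A0: "fps_nth ?A 0 = 0" by (simp add: fps_arctan_def)
  have s': "fps_deriv ?s = ?c * fps_deriv ?A"
    by (simp add: fps_compose_deriv[OF A0] fps_sin_deriv)
  have c': "fps_deriv ?c = - (?s * fps_deriv ?A)"
    by (simp add: fps_compose_deriv[OF A0] fps_cos_deriv fps_compose_uminus fps_const_neg[symmetric] del: fps_const_neg)
  have "(1 + fps_X ^ 2) * fps_deriv y = ?c * ((1 + fps_X ^ 2) * fps_deriv ?A) - (1 + fps_X ^ 2) * ?c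
      + fps_X * ?s * ((1 + fps_X ^ 2) * fps_deriv ?A)"
    by (simp add: y_def s' c' algebra_simps)
  also have "\<dots> = fps_X * y"
    unfolding fps_deriv_arctan by (simp add: y_def algebra_simps power2_eq_square)
  finally have ode: "(1 + fps_X ^ 2) * fps_deriv y = fps_X * y" .
  have "fps_nth y n = 0" for n
  proof (induction n rule: less_induct)
    case (less n)
    show ?case
    proof (cases n)
      case 0
      then show ?thesis by (simp add: y_def)
    next
      case (Suc k)
      have "fps_nth ((1 + fps_X ^ 2) * fps_deriv y) k = 0"
        unfolding ode using less.IH[of "k - 1"] Suc by simp
      moreover have "fps_nth (fps_X ^ 2 * fps_deriv y) k = 0"
        using less.IH[of "Suc (k - 2)"] Suc by (simp add: fps_X_power_mult_nth)
      ultimately show ?thesis using Suc by (simp add: distrib_right del: of_nat_Suc)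
    qed
  qed
  then have "y = 0" by (intro fps_ext) simp
  then show ?thesis by (simp add: y_def)
qed

lemma cos_compose_arctan_squared: "(fps_cos 1 oo fps_arctan) ^ 2 * (1 + fps_X ^ 2) = 1"
proof -
  have A0: "fps_nth fps_arctan 0 = 0" by (simp add: fps_arctan_def)
  have "(fps_cos 1 oo fps_arctan) ^ 2 + (fps_sin 1 oo fps_arctan) ^ 2 = 1"
    using arg_cong[OF fps_sin_cos_sum_of_squares[of "1 :: real"], of "\<lambda>f. f oo fps_arctan"]
    by (simp add: fps_compose_add_distrib power2_eq_square fps_compose_mult_distrib[OF A0])
  then show ?thesis by (simp add: sin_compose_arctan power_mult_distrib algebra_simps)
qed

lemma umbral_sinh_arctan:
  "umbral_eval (const_in_E fps_sinh oo (umbral_E * const_in_E fps_arctan)) = fps_X"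
proof -
  have A0: "fps_nth fps_arctan 0 = 0" by (simp add: fps_arctan_def)
  let ?c = "fps_cos 1 oo fps_arctan" and ?S = "Abs_fps (\<lambda>k. fps_nth fps_sinh k * euler_number k)"
  have "?c * (?S oo fps_arctan) = ?c * fps_X"
    using cos_mult_umbral_sinh_cosh(1) by (simp add: fps_compose_mult_distrib[OF A0, symmetric] sin_compose_arctan mult.commute)
  moreover have "?c \<noteq> 0" using cos_compose_arctan_squared by auto
  ultimately show ?thesis by (simp add: umbral_eval_compose_arctan)
qed

text \<open>The evaluated series is the reciprocal of \<open>cos (arctan t)\<close>, so its square
  is \<open>1 + t^2\<close>; its constant term 1 selects the root.\<close>

lemma umbral_cosh_arctan:
  "umbral_eval (const_in_E fps_cosh oo (umbral_E * const_in_E fps_arctan)) = fps_sqrt_1_plus_sq"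
proof -
  have A0: "fps_nth fps_arctan 0 = 0" by (simp add: fps_arctan_def)
  let ?c = "fps_cos 1 oo fps_arctan" and ?C = "Abs_fps (\<lambda>k. fps_nth fps_cosh k * euler_number k)"
  let ?D = "?C oo fps_arctan"
  have cD: "?c * ?D = 1"
    using cos_mult_umbral_sinh_cosh(2) by (simp add: fps_compose_mult_distrib[OF A0, symmetric])
  have "?D ^ 2 = ?D ^ 2 * (?c ^ 2 * (1 + fps_X ^ 2))"
    by (simp add: cos_compose_arctan_squared)
  also have "\<dots> = (?c * ?D) ^ 2 * (1 + fps_X ^ 2)"
    by (simp only: power_mult_distrib mult_ac)
  finally have "?D ^ Suc 1 = 1 + fps_X ^ 2" by (simp add: cD numeral_2_eq_2)
  then have "?D = fps_radical root (Suc 1) (1 + fps_X ^ 2)"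
    by (subst radical_unique[symmetric]) (auto simp: fps_cosh_def)
  then show ?thesis
    by (simp add: umbral_eval_compose_arctan fps_sqrt_1_plus_sq_def numeral_2_eq_2)
qed

lemma fps_sqrt_1_plus_sq_squared:
  "fps_sqrt_1_plus_sq * fps_sqrt_1_plus_sq = 1 + fps_X ^ 2"
  "inverse fps_sqrt_1_plus_sq * fps_sqrt_1_plus_sq = 1"
proof -
  have "fps_radical root (Suc 1) (1 + fps_X ^ 2 :: real fps) ^ Suc 1 = 1 + fps_X ^ 2"
    by (subst power_radical[symmetric]) auto
  then show sq: "fps_sqrt_1_plus_sq * fps_sqrt_1_plus_sq = 1 + fps_X ^ 2"
    by (simp add: fps_sqrt_1_plus_sq_def numeral_2_eq_2)
  have "fps_nth (fps_sqrt_1_plus_sq * fps_sqrt_1_plus_sq) 0 = 1" unfolding sq by simp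
  then have "fps_nth fps_sqrt_1_plus_sq 0 \<noteq> 0" by auto
  then show "inverse fps_sqrt_1_plus_sq * fps_sqrt_1_plus_sq = 1" by (rule inverse_mult_eq_1)
qed

lemma uniform_perms_1: "uniform_perms 1 n = {id}"
proof (intro equalityI subsetI)
  fix p assume p: "p \<in> uniform_perms 1 n"
  have "p i = i" for i
    using uniform_permsD(1)[OF p] uniform_permsD(2)[OF p, of i] by (cases "i \<in> {1..n}") (auto simp: permutes_not_in)
  then show "p \<in> {id}" by auto
qed (auto simp: uniform_perms_def permutes_id)

text \<open>The identity has only ascents: alternation fails at position 1, reverse alternation at
  position 2. The series are \<open>1 + t\<close> and \<open>1 + t + t^2\<close>.\<close>

lemma b_alt_1: "b_alt 1 r = of_bool (r \<le> 1)" "b_star 1 r = of_bool (r \<le> 2)"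
proof -
  have alt: "{p. p permutes {1..1 * r} \<and> alternating (1 * r) p \<and> (\<forall>C\<in>perm_cycles (1 * r) p. card C = 1)} =
      {p \<in> uniform_perms 1 r. alternating r p}"
    unfolding uniform_perms_eq_cycles[OF zero_less_one] by auto
  have rev: "{p. p permutes {1..1 * r} \<and> reverse_alternating (1 * r) p \<and> (\<forall>C\<in>perm_cycles (1 * r) p. card C = 1)} =
      {p \<in> uniform_perms 1 r. reverse_alternating r p}"
    unfolding uniform_perms_eq_cycles[OF zero_less_one] by auto
  have "alternating r id \<longleftrightarrow> r \<le> 1"
    unfolding alternating_def using not_less by (auto dest: spec[of _ 1])
  moreover have "reverse_alternating r id \<longleftrightarrow> r \<le> 2"
  proof
    assume "reverse_alternating r id"
    then show "r \<le> 2"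
      unfolding reverse_alternating_def by (auto dest!: spec[of _ 2])
  next
    assume "r \<le> 2"
    show "reverse_alternating r id"
      unfolding reverse_alternating_def
    proof (intro allI impI)
      fix i assume "1 \<le> i \<and> i < r"
      with \<open>r \<le> 2\<close> have "i = 1" by linarith
      then show "if odd i then id i < id (i + 1) else id (i + 1) < id i" by simp
    qed
  qed
  moreover have "{p \<in> {id}. P p} = (if P id then {id} else {})" for P :: "(nat \<Rightarrow> nat) \<Rightarrow> bool"
    by auto
  ultimately show "b_alt 1 r = of_bool (r \<le> 1)" "b_star 1 r = of_bool (r \<le> 2)"
    unfolding b_alt_def b_star_def alt rev uniform_perms_1 by simp_all
qed

theorem theorem5p4:
  shows "(\<forall>m. odd m \<and> m \<ge> 3 \<longrightarrow>
            F_alt m = F_star m \<and>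
            F_star m = umbral_eval (const_in_E (fps_exp 1) oo (cycle_poly m * const_in_E fps_arctan))) \<and>
         F_alt 1 = umbral_eval
           ((const_in_E fps_sinh oo (umbral_E * const_in_E fps_arctan)) +
            const_in_E (inverse fps_sqrt_1_plus_sq) *
              (const_in_E fps_cosh oo (umbral_E * const_in_E fps_arctan))) \<and>
         F_star 1 = umbral_eval
           ((const_in_E fps_sinh oo (umbral_E * const_in_E fps_arctan)) +
            const_in_E fps_sqrt_1_plus_sq *
              (const_in_E fps_cosh oo (umbral_E * const_in_E fps_arctan)))"
proof (intro conjI allI impI)
  fix m :: nat assume m: "odd m \<and> m \<ge> 3"
  let ?H = "const_in_E (fps_exp 1) oo (cycle_poly m * const_in_E fps_arctan)"
  let ?Q = "fps_nth ?H"
  have Q0: "?Q 0 = 1"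
    unfolding cycle_poly_eq by (rule exp_arctan_rec(1))
  have Q: "of_nat (r * m) * ?Q r =
      (\<Sum>k=1..r. if odd k then smult ((-1) ^ ((k - 1) div 2)) (cycle_exponent m * ?Q (r - k)) else 0)" for r
  proof -
    have "of_nat (r * m) * ?Q r = smult (real m) (of_nat r * ?Q r)"
      by (simp add: of_nat_poly mult_ac)
    also have "of_nat r * ?Q r = (\<Sum>k=1..r. if odd k then smult ((-1) ^ ((k - 1) div 2))
        (smult (1 / real m) (cycle_exponent m) * ?Q (r - k)) else 0)"
      unfolding cycle_poly_eq by (rule exp_arctan_rec(2))
    also have "smult (real m) \<dots> =
        (\<Sum>k=1..r. if odd k then smult ((-1) ^ ((k - 1) div 2)) (cycle_exponent m * ?Q (r - k)) else 0)"
      unfolding smult_sum using m by (intro sum.cong refl) auto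
    finally show ?thesis .
  qed
  have ribbon: "ribbon e (m * r) (necklace_count m) = umbral_eval_poly (?Q r)" if "r > 0" for e r
    using ribbon_necklace_count[of m ?Q 0 r e, OF _ _ Q0 Q] m that by (simp add: mult.commute)
  have "real (b_alt m r) = umbral_eval_poly (?Q r) \<and> real (b_star m r) = umbral_eval_poly (?Q r)" for r
  proof (cases "r = 0")
    case True
    then show ?thesis
      using umbral_eval_poly_monom[of 1 0] unfolding True b_alt_0 Q0 by (simp add: monom_0 one_pCons)
  next
    case False
    then show ?thesis using real_b_alt[of m r] ribbon[of r] m by simp
  qed
  then show "F_alt m = F_star m" "F_star m = umbral_eval ?H"
    by (simp_all add: F_alt_def F_star_def umbral_eval_def)
next
  show "F_alt 1 = umbral_eval
       ((const_in_E fps_sinh oo (umbral_E * const_in_E fps_arctan)) +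
        const_in_E (inverse fps_sqrt_1_plus_sq) *
          (const_in_E fps_cosh oo (umbral_E * const_in_E fps_arctan)))"
    unfolding umbral_eval_add umbral_eval_const_mult umbral_sinh_arctan umbral_cosh_arctan
      fps_sqrt_1_plus_sq_squared F_alt_def b_alt_1
    by (rule fps_ext) (auto simp: fps_one_nth)
  show "F_star 1 = umbral_eval
       ((const_in_E fps_sinh oo (umbral_E * const_in_E fps_arctan)) +
        const_in_E fps_sqrt_1_plus_sq *
          (const_in_E fps_cosh oo (umbral_E * const_in_E fps_arctan)))"
    unfolding umbral_eval_add umbral_eval_const_mult umbral_sinh_arctan umbral_cosh_arctan
      fps_sqrt_1_plus_sq_squared F_star_def b_alt_1
    by (rule fps_ext) (auto simp: fps_X_power_nth le_Suc_eq numeral_2_eq_2)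
qed

end
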